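(* Let $1\le n<\omega$ and $\aleph_0\le\kappa\le 2^{\aleph_0}$. Let $\mathcal{H}$ be a set of algebraic hypergraphs with vertex set $\mathbb{R}^n$ (each $H\in\mathcal{H}$ being a $k_H$-hypergraph for some $2\le k_H<\omega$) with $|\mathcal{H}|\le\kappa$. Then there is a collection $\mathcal{A}$ of sets with $|\mathcal{A}|\le\kappa$ and $\mathbb{R}^n=\bigcup\mathcal{A}$ such that for each $A\in\mathcal{A}$ there are $d<\omega$ and a map $g:A\to\mathbb{R}^d$ such that for every $H\in\mathcal{H}$, $g$ is an isomorphism from $H[A]$ onto some algebraic multi-template $k_H$-hypergraph $L(\mathbb{R}^d,\mathcal{P})$ (where $\mathcal{P}$ is a set of $d$-dimensional $k_H$-templates depending on $H$ and $A$).
   Context: For $2\le k<\omega$, a $k$-hypergraph is a pair $H=(V,E)$ with $E\subseteq[V]^k$ (the $k$-element subsets of $V$). For $A\subseteq V$, the induced subhypergraph is $H[A]=(A,E\cap[A]^k)$. An isomorphism between $k$-hypergraphs is a bijection between vertex sets mapping edges exactly onto edges. A $k$-hypergraph is algebraic if there are $n<\omega$ and a real polynomial $p(x_0,\dots,x_{k-1})$ (each $x_i$ an $n$-tuple of variables) such that $V=\mathbb{R}^n$ and $E$ is the set of $\{a_0,\dots,a_{k-1}\}\in[\mathbb{R}^n]^k$ (for some enumeration of its elements) with $p(a_0,\dots,a_{k-1})=0$. A $d$-dimensional $k$-template is a set $P$ of $d$-tuples with $|P|=k$. For $d$-dimensional $k$-templates $P,Q$, a homomorphism $f:P\to Q$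 is a one-to-one map such that whenever $x,y\in P$, $i<d$ and $x_i=y_i$, then $f(x)_i=f(y)_i$; $Q$ is a homomorphic image of $P$ if such an $f$ exists. For sets $X_0,\dots,X_{d-1}$, $X=X_0\times\cdots\times X_{d-1}$, and a set $\mathcal{P}$ of $d$-dimensional $k$-templates (possibly empty), the multi-template hypergraph $L(X,\mathcal{P})$ is the $k$-hypergraph $(X,F)$ where $F$ is the set of $Q\in[X]^k$ that are homomorphic images of some $P\in\mathcal{P}$. *)

theory Defs
  imports Complex_Main "HOL-Library.Ramsey"
begin

definition Rn :: "nat \<Rightarrow> real list set" where
  "Rn n = {x. length x = n}"

inductive poly_fun :: "nat \<Rightarrow> ((nat \<Rightarrow> real) \<Rightarrow> real) \<Rightarrow> bool" for N :: nat where
  pconst: "poly_fun N (\<lambda>x. c)"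
| pvar: "i < N \<Longrightarrow> poly_fun N (\<lambda>x. x i)"
| padd: "poly_fun N p \<Longrightarrow> poly_fun N q \<Longrightarrow> poly_fun N (\<lambda>x. p x + q x)"
| pmult: "poly_fun N p \<Longrightarrow> poly_fun N q \<Longrightarrow> poly_fun N (\<lambda>x. p x * q x)"

definition is_hypergraph :: "nat \<Rightarrow> 'a set \<Rightarrow> 'a set set \<Rightarrow> bool" where
  "is_hypergraph k V E \<longleftrightarrow> E \<subseteq> nsets V k"

definition induced_edges :: "nat \<Rightarrow> 'a set set \<Rightarrow> 'a set \<Rightarrow> 'a set set" where
  "induced_edges k E A = E \<inter> nsets A k"

definition hyp_iso :: "('a \<Rightarrow> 'b) \<Rightarrow> 'a set \<Rightarrow> 'a set set \<Rightarrow> 'b set \<Rightarrow> 'b set set \<Rightarrow> bool" where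
  "hyp_iso g V1 E1 V2 E2 \<longleftrightarrow> bij_betw g V1 V2 \<and> (\<lambda>e. g ` e) ` E1 = E2"

text \<open>Algebraic k-hypergraph on R^n with edge set E: there is a real polynomial p in the
  k*n variables (x_0,...,x_{k-1}), variable number i*n+j being the j-th coordinate of x_i,
  such that E consists of those k-subsets of R^n having an enumeration a_0..a_{k-1}
  with p(a_0,...,a_{k-1}) = 0.\<close>
definition algebraic_hg :: "nat \<Rightarrow> nat \<Rightarrow> real list set set \<Rightarrow> bool" where
  "algebraic_hg n k E \<longleftrightarrow>
     (\<exists>p. poly_fun (k * n) p \<and>
        E = {e \<in> nsets (Rn n) k. \<exists>a. bij_betw a {..<k} e \<and> p (\<lambda>v. a (v div n) ! (v mod n)) = 0})"

definition template :: "nat \<Rightarrow> nat \<Rightarrow> nat list set \<Rightarrow> bool" where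
  "template d k P \<longleftrightarrow> (\<forall>x\<in>P. length x = d) \<and> finite P \<and> card P = k"

definition template_hom :: "nat \<Rightarrow> ('a list \<Rightarrow> 'b list) \<Rightarrow> 'a list set \<Rightarrow> 'b list set \<Rightarrow> bool" where
  "template_hom d f P Q \<longleftrightarrow> f ` P \<subseteq> Q \<and> inj_on f P \<and>
     (\<forall>x\<in>P. \<forall>y\<in>P. \<forall>i<d. x ! i = y ! i \<longrightarrow> f x ! i = f y ! i)"

definition hom_image :: "nat \<Rightarrow> 'a list set \<Rightarrow> 'b list set \<Rightarrow> bool" where
  "hom_image d P Q \<longleftrightarrow> (\<exists>f. template_hom d f P Q)"

definition L_edges :: "nat \<Rightarrow> nat \<Rightarrow> nat list set set \<Rightarrow> real list set set" where
  "L_edges d k \<P> = {Q \<in> nsets (Rn d) k. \<exists>P\<in>\<P>. hom_image d P Q}"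

end

theory Submission
  imports Defs "HOL-Complex_Analysis.Complex_Analysis"
begin

text \<open>
  Let \<open>F\<close> collect the coefficients of all polynomials involved, and let \<open>Cl F\<close> be the least class of
  functions of complex variables that contains \<open>F\<close> and the coordinates and is closed under arithmetic,
  conjugation, rational substitutions and integration over rational circles in one variable; its
  cardinality is at most \<open>\<kappa>\<close>. Call a set \<open>T\<close> of reals independent if a function in \<open>Cl F\<close> that is
  holomorphic on a polydisc vanishes identically there as soon as it vanishes at one point whose
  coordinates are distinct elements of \<open>T\<close>. For a maximal such \<open>T\<close>, every real is the value of a function
  in \<open>Cl F\<close> at a tuple from \<open>T\<close>, because an isolated zero is a quotient of two contour integrals.

  A piece is the image of the \<open>d\<close>-tuples from \<open>T\<close> in a rational polydisc with disjoint factors under an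
  \<open>n\<close>-tuple of functions in \<open>Cl F\<close>; it is parametrised injectively if \<open>d\<close> is minimal for some point of
  it. If \<open>\<kappa>\<close> is less than the continuum, \<open>T\<close> can be chosen to meet every interval in continuum many
  points, so the parameter set is a copy of \<open>\<real>\<^sup>d\<close>. By independence, whether a polynomial over \<open>F\<close> vanishes
  at \<open>k\<close> points of the piece is inherited by all configurations with at least the same coincidences of
  coordinates, that is, the edges are closed under template homomorphisms.
\<close>

unbundle cardinal_syntax

section \<open>Holomorphy along plots\<close>

text \<open>The set \<open>U\<close> need not be open. Testing holomorphy only along one-parameter families in \<open>U\<close> allows
  sets in which some coordinates are confined to circles, over which one then integrates.\<close>

definition hol :: "(nat \<Rightarrow> complex) set \<Rightarrow> ((nat \<Rightarrow> complex) \<Rightarrow> complex) \<Rightarrow> bool" where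
  "hol U f \<longleftrightarrow> continuous_on U f \<and>
     (\<forall>S \<gamma>. open S \<longrightarrow> (\<forall>i. (\<lambda>s. \<gamma> s i) holomorphic_on S) \<longrightarrow> \<gamma> ` S \<subseteq> U \<longrightarrow>
        (\<lambda>s. f (\<gamma> s)) holomorphic_on S)"

lemma holI:
  assumes "continuous_on U f"
    and "\<And>S \<gamma>. open S \<Longrightarrow> (\<And>i. (\<lambda>s. \<gamma> s i) holomorphic_on S) \<Longrightarrow> \<gamma> ` S \<subseteq> U \<Longrightarrow>
           (\<lambda>s. f (\<gamma> s)) holomorphic_on S"
  shows "hol U f"
  using assms unfolding hol_def by blast

lemma hol_imp_continuous_on: "hol U f \<Longrightarrow> continuous_on U f"
  by (simp add: hol_def)

lemma hol_plot:
  assumes "hol U f" "open S" "\<And>i. (\<lambda>s. \<gamma> s i) holomorphic_on S" "\<gamma> ` S \<subseteq> U"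
  shows "(\<lambda>s. f (\<gamma> s)) holomorphic_on S"
  using assms unfolding hol_def by blast

lemma hol_subset: "hol U f \<Longrightarrow> V \<subseteq> U \<Longrightarrow> hol V f"
  unfolding hol_def by (meson continuous_on_subset order_trans)

lemma hol_const: "hol U (\<lambda>x. c)"
  by (rule holI) auto

lemma hol_var: "hol U (\<lambda>x. x i)"
  by (rule holI) (auto intro: continuous_on_product_coordinates continuous_on_subset)

lemma hol_add: "hol U f \<Longrightarrow> hol U g \<Longrightarrow> hol U (\<lambda>x. f x + g x)"
  by (rule holI) (auto intro!: continuous_intros holomorphic_intros intro: hol_imp_continuous_on hol_plot)

lemma hol_mult: "hol U f \<Longrightarrow> hol U g \<Longrightarrow> hol U (\<lambda>x. f x * g x)"
  by (rule holI) (auto intro!: continuous_intros holomorphic_intros intro: hol_imp_continuous_on hol_plot)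

lemma hol_inverse: "hol U f \<Longrightarrow> (\<And>x. x \<in> U \<Longrightarrow> f x \<noteq> 0) \<Longrightarrow> hol U (\<lambda>x. inverse (f x))"
  by (rule holI) (auto intro!: continuous_intros holomorphic_intros intro: hol_imp_continuous_on hol_plot)

lemma hol_compose:
  assumes f: "hol V f" and s: "\<And>i. hol U (\<lambda>x. \<sigma> x i)" and UV: "\<And>x. x \<in> U \<Longrightarrow> \<sigma> x \<in> V"
  shows "hol U (\<lambda>x. f (\<sigma> x))"
proof (rule holI)
  show "continuous_on U (\<lambda>x. f (\<sigma> x))"
    using UV by (intro continuous_on_compose2[OF hol_imp_continuous_on[OF f]] continuous_on_coordinatewise_then_product
        hol_imp_continuous_on[OF s]) auto
next
  fix S \<gamma> assume "open S" "\<And>i. (\<lambda>s. \<gamma> s i) holomorphic_on S" "\<gamma> ` S \<subseteq> U"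
  then show "(\<lambda>s. f (\<sigma> (\<gamma> s))) holomorphic_on S"
    using UV by (intro hol_plot[OF f]) (auto intro: hol_plot[OF s])
qed

lemma hol_cnj:
  assumes f: "hol V f" and UV: "\<And>x. x \<in> U \<Longrightarrow> (\<lambda>i. cnj (x i)) \<in> V"
  shows "hol U (\<lambda>x. cnj (f (\<lambda>i. cnj (x i))))"
proof (rule holI)
  show "continuous_on U (\<lambda>x. cnj (f (\<lambda>i. cnj (x i))))"
    using UV by (intro continuous_on_cnj continuous_on_compose2[OF hol_imp_continuous_on[OF f]]
        continuous_on_coordinatewise_then_product hol_imp_continuous_on[OF hol_var]) auto
next
  fix S \<gamma> assume S: "open S" "\<And>i. (\<lambda>s. \<gamma> s i) holomorphic_on S" "\<gamma> ` S \<subseteq> U"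
  have [simp]: "cnj ` cnj ` S = S" by (force simp: image_iff)
  have "(cnj \<circ> (\<lambda>s. f (\<lambda>i. cnj (\<gamma> (cnj s) i))) \<circ> cnj) holomorphic_on cnj ` cnj ` S"
  proof (rule holomorphic_on_compose_cnj_cnj)
    have op: "open (cnj ` S)"
    proof -
      have "cnj ` S = cnj -` S" by (force simp: image_iff)
      then show ?thesis using S(1) by (simp add: open_vimage continuous_on_cnj)
    qed
    show "open (cnj ` cnj ` S)" using S by simp
    have "(\<lambda>s. cnj (\<gamma> (cnj s) i)) holomorphic_on cnj ` S" for i
      using holomorphic_on_compose_cnj_cnj[of "\<lambda>s. \<gamma> s i" "cnj ` S"] S op by (simp add: o_def)
    then show "(\<lambda>s. f (\<lambda>i. cnj (\<gamma> (cnj s) i))) holomorphic_on cnj ` cnj ` cnj ` S"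
      using UV S op by (intro hol_plot[OF f]) (auto simp: image_image)
  qed
  then show "(\<lambda>s. cnj (f (\<lambda>i. cnj (\<gamma> s i)))) holomorphic_on S"
    by (simp add: o_def)
qed

lemma contour_integral_circlepath_param_continuous:
  fixes F :: "'a::topological_space \<Rightarrow> complex \<Rightarrow> complex"
  assumes F: "continuous_on (U \<times> sphere c r) (\<lambda>(x, w). F x w)" and r: "0 \<le> r"
  shows "continuous_on U (\<lambda>x. contour_integral (circlepath c r) (F x))"
proof -
  have "continuous_on (U \<times> {0..1}) (\<lambda>(x,t). F x (circlepath c r t) * vector_derivative (circlepath c r) (at t))"
  proof -
    have c: "continuous_on (U \<times> {0..1}) (\<lambda>p. (fst p, circlepath c r (snd p)))"
      unfolding circlepath by (intro continuous_intros)
    have "continuous_on (U \<times> {0..1}) (\<lambda>p. case (fst p, circlepath c r (snd p)) of (x,w) \<Rightarrow> F x w)"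
      using r by (intro continuous_on_compose2[OF F c])
        (auto simp: path_image_def path_image_circlepath_nonneg[symmetric])
    then show ?thesis
      unfolding vector_derivative_circlepath
      by (auto simp: case_prod_unfold intro!: continuous_intros)
  qed
  then show ?thesis
    unfolding contour_integral_integral
    using integral_continuous_on_param[of U 0 "1::real" "\<lambda>x t. F x (circlepath c r t) * vector_derivative (circlepath c r) (at t)"]
    by simp
qed

text \<open>Morera's theorem, after exchanging the circle with the sides of a triangle.\<close>

lemma hol_contour_integral:
  assumes f: "hol V f" and UV: "\<And>x w. x \<in> U \<Longrightarrow> w \<in> sphere c r \<Longrightarrow> x(m := w) \<in> V" and r: "0 < r"
  shows "hol U (\<lambda>x. contour_integral (circlepath c r) (\<lambda>w. f (x(m := w))))"
proof (rule holI)
  have "continuous_on (U \<times> sphere c r) (\<lambda>p. f ((fst p)(m := snd p)))"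
  proof (rule continuous_on_compose2[OF hol_imp_continuous_on[OF f]])
    show "continuous_on (U \<times> sphere c r) (\<lambda>p. (fst p)(m := snd p))"
    proof (rule continuous_on_coordinatewise_then_product)
      fix i
      have "continuous_on (U \<times> sphere c r) (\<lambda>p. fst p i)"
        by (rule continuous_on_compose2[OF continuous_on_product_coordinates[of i]]) (auto intro: continuous_intros)
      then show "continuous_on (U \<times> sphere c r) (\<lambda>p. ((fst p)(m := snd p)) i)"
        by (cases "i = m") (auto intro: continuous_intros)
    qed
  qed (use UV in auto)
  then show "continuous_on U (\<lambda>x. contour_integral (circlepath c r) (\<lambda>w. f (x(m := w))))"
    using r by (intro contour_integral_circlepath_param_continuous) (auto simp: case_prod_unfold)
next
  fix S \<gamma> assume S: "open S" and \<gamma>: "\<And>i. (\<lambda>s. \<gamma> s i) holomorphic_on S" "\<gamma> ` S \<subseteq> U"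
  let ?F = "\<lambda>s w. f ((\<gamma> s)(m := w))"
  let ?I = "\<lambda>s. contour_integral (circlepath c r) (?F s)"
  have cF: "continuous_on (S \<times> sphere c r) (\<lambda>p. ?F (fst p) (snd p))"
  proof (rule continuous_on_compose2[OF hol_imp_continuous_on[OF f]])
    show "continuous_on (S \<times> sphere c r) (\<lambda>p. (\<gamma> (fst p))(m := snd p))"
    proof (rule continuous_on_coordinatewise_then_product)
      fix i
      have "continuous_on (S \<times> sphere c r) (\<lambda>p. \<gamma> (fst p) i)"
        by (rule continuous_on_compose2[OF holomorphic_on_imp_continuous_on[OF \<gamma>(1)[of i]]]) (auto intro: continuous_intros)
      then show "continuous_on (S \<times> sphere c r) (\<lambda>p. ((\<gamma> (fst p))(m := snd p)) i)"
        by (cases "i = m") (auto intro: continuous_intros)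
    qed
  qed (use UV \<gamma>(2) in auto)
  have cI: "continuous_on S ?I"
    using r cF by (intro contour_integral_circlepath_param_continuous) (auto simp: case_prod_unfold)
  have hF: "(\<lambda>s. ?F s w) holomorphic_on S" if "w \<in> sphere c r" for w
  proof (rule hol_plot[OF f S])
    show "(\<lambda>s. ((\<gamma> s)(m := w)) i) holomorphic_on S" for i
      using \<gamma>(1)[of i] by (cases "i = m") auto
  qed (use that UV \<gamma>(2) in auto)
  have "?I analytic_on S"
  proof (rule Morera_triangle[OF cI S], rule impI)
    fix a b d assume T: "convex hull {a,b,d} \<subseteq> S"
    have seg: "closed_segment a b \<subseteq> convex hull {a,b,d}" "closed_segment b d \<subseteq> convex hull {a,b,d}"
      "closed_segment d a \<subseteq> convex hull {a,b,d}"
      unfolding segment_convex_hull by (auto intro!: hull_mono)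
    have sw: "contour_integral (linepath p q) ?I =
        contour_integral (circlepath c r) (\<lambda>w. contour_integral (linepath p q) (\<lambda>s. ?F s w))"
      if "closed_segment p q \<subseteq> S" for p q
    proof (rule contour_integral_swap)
      show "continuous_on (path_image (linepath p q) \<times> path_image (circlepath c r)) (\<lambda>(s, w). ?F s w)"
        unfolding case_prod_unfold using r that by (intro continuous_on_subset[OF cF]) auto
    next
      show "continuous_on {0..1} (\<lambda>t. vector_derivative (linepath p q) (at t))"
        by (simp add: vector_derivative_linepath_at)
      show "continuous_on {0..1} (\<lambda>t. vector_derivative (circlepath c r) (at t))"
        unfolding vector_derivative_circlepath by (intro continuous_intros)
    qed auto
    have ci: "continuous_on (sphere c r) (\<lambda>w. contour_integral (linepath p q) (\<lambda>s. ?F s w))"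
      if "closed_segment p q \<subseteq> S" for p q
    proof -
      have "continuous_on (sphere c r \<times> {0..1}) (\<lambda>(w,t). ?F (linepath p q t) w * (q - p))"
      proof -
        have "continuous_on (sphere c r \<times> {0..1}) (\<lambda>z. (linepath p q (snd z), fst z))"
          unfolding linepath_def by (intro continuous_intros)
        moreover have "(\<lambda>z. (linepath p q (snd z), fst z)) ` (sphere c r \<times> {0..1}) \<subseteq> S \<times> sphere c r"
          using that linepath_in_path[of _ p q] by auto
        ultimately have "continuous_on (sphere c r \<times> {0..1}) (\<lambda>z. ?F (linepath p q (snd z)) (fst z))"
          using continuous_on_compose2[OF cF, of "sphere c r \<times> {0..1}" "\<lambda>z. (linepath p q (snd z), fst z)"] by simp
        then show ?thesis by (auto simp: case_prod_unfold intro: continuous_intros)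
      qed
      from integral_continuous_on_param[of _ 0 "1::real", unfolded cbox_interval, OF this] show ?thesis
        unfolding contour_integral_integral vector_derivative_linepath_at by simp
    qed
    have int: "(\<lambda>w. contour_integral (linepath p q) (\<lambda>s. ?F s w)) contour_integrable_on circlepath c r"
      if "closed_segment p q \<subseteq> S" for p q
      using r ci[OF that] by (intro contour_integrable_continuous_circlepath) auto
    have "contour_integral (linepath a b) ?I + contour_integral (linepath b d) ?I + contour_integral (linepath d a) ?I
      = contour_integral (circlepath c r) (\<lambda>w. contour_integral (linepath a b) (\<lambda>s. ?F s w)
          + contour_integral (linepath b d) (\<lambda>s. ?F s w) + contour_integral (linepath d a) (\<lambda>s. ?F s w))"
    proof -
      have s: "closed_segment a b \<subseteq> S" "closed_segment b d \<subseteq> S" "closed_segment d a \<subseteq> S"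
        using seg T by auto
      show ?thesis
        unfolding sw[OF s(1)] sw[OF s(2)] sw[OF s(3)]
        by (simp add: contour_integral_add contour_integrable_add int s)
    qed
    also have "\<dots> = contour_integral (circlepath c r) (\<lambda>w. 0)"
    proof (rule contour_integral_eq)
      fix w assume w: "w \<in> path_image (circlepath c r)"
      then have "((\<lambda>s. ?F s w) has_contour_integral 0) (linepath a b +++ linepath b d +++ linepath d a)"
        using r T by (intro Cauchy_theorem_triangle holomorphic_on_subset[OF hF]) auto
      then have "contour_integral (linepath a b +++ linepath b d +++ linepath d a) (\<lambda>s. ?F s w) = 0"
        by (rule contour_integral_unique)
      moreover have "(\<lambda>s. ?F s w) contour_integrable_on linepath p q" if "closed_segment p q \<subseteq> S" for p q
        using r w that by (intro contour_integrable_continuous_linepath 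
            continuous_on_subset[OF holomorphic_on_imp_continuous_on[OF hF]]) auto
      then have "(\<lambda>s. ?F s w) contour_integrable_on linepath a b" "(\<lambda>s. ?F s w) contour_integrable_on linepath b d"
        "(\<lambda>s. ?F s w) contour_integrable_on linepath d a"
        using seg T by auto
      ultimately show "contour_integral (linepath a b) (\<lambda>s. ?F s w)
          + contour_integral (linepath b d) (\<lambda>s. ?F s w) + contour_integral (linepath d a) (\<lambda>s. ?F s w) = 0"
        by (simp add: contour_integrable_joinI add.assoc)
    qed
    finally show "contour_integral (linepath a b) ?I + contour_integral (linepath b d) ?I + contour_integral (linepath d a) ?I = 0"
      by simp
  qed
  then show "?I holomorphic_on S"
    by (rule analytic_imp_holomorphic)
qed

section \<open>The class of functions generated by a set of reals\<close>

lemma of_real_of_rat_eq [simp]: "of_real (of_rat q) = (of_rat q :: 'a :: real_field)"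
  by (cases q) (simp add: of_rat_rat)

definition emb :: "real list \<Rightarrow> nat \<Rightarrow> complex" where
  "emb us i = (if i < length us then of_real (us ! i) else 0)"

definition polydisc :: "real list \<Rightarrow> real \<Rightarrow> (nat \<Rightarrow> complex) set" where
  "polydisc cs e = 
    {x. (\<forall>i<length cs. dist (x i) (of_real (cs ! i)) < e) \<and> (\<forall>i\<ge>length cs. x i = 0)}"

text \<open>On a polydisc with \<open>m\<close> centers the coordinates from \<open>m\<close> on are 0, so that an index \<open>j \<ge> m\<close> in
  \<open>(q, j)\<close> makes the corresponding argument the constant \<open>q\<close>. The function \<open>act\<close> does to real points
  what \<open>sub\<close> does to their embeddings.\<close>

definition sub :: "(rat \<times> nat) list \<Rightarrow> (nat \<Rightarrow> complex) \<Rightarrow> nat \<Rightarrow> complex" where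
  "sub l x i = (if i < length l then of_rat (fst (l ! i)) + x (snd (l ! i)) else 0)"

definition act :: "(rat \<times> nat) list \<Rightarrow> real list \<Rightarrow> real list" where
  "act l us = map (\<lambda>(q, j). of_rat q + (if j < length us then us ! j else 0)) l"

inductive_set Cl :: "real set \<Rightarrow> ((nat \<Rightarrow> complex) \<Rightarrow> complex) set" for F where
  Cl_const: "c \<in> F \<Longrightarrow> (\<lambda>x. of_real c) \<in> Cl F"
| Cl_rat: "(\<lambda>x. of_rat q) \<in> Cl F"
| Cl_var: "(\<lambda>x. x i) \<in> Cl F"
| Cl_add: "f \<in> Cl F \<Longrightarrow> g \<in> Cl F \<Longrightarrow> (\<lambda>x. f x + g x) \<in> Cl F"
| Cl_mult: "f \<in> Cl F \<Longrightarrow> g \<in> Cl F \<Longrightarrow> (\<lambda>x. f x * g x) \<in> Cl F"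
| Cl_inverse: "f \<in> Cl F \<Longrightarrow> (\<lambda>x. inverse (f x)) \<in> Cl F"
| Cl_cnj: "f \<in> Cl F \<Longrightarrow> (\<lambda>x. cnj (f (\<lambda>i. cnj (x i)))) \<in> Cl F"
| Cl_sub: "f \<in> Cl F \<Longrightarrow> (\<lambda>x. f (sub l x)) \<in> Cl F"
| Cl_contour: "f \<in> Cl F \<Longrightarrow>
    (\<lambda>x. contour_integral (circlepath (of_rat c) (of_rat r)) (\<lambda>w. f (x(m := w)))) \<in> Cl F"

lemma card_of_image_le: "|A| \<le>o |M| \<Longrightarrow> |f ` A| \<le>o |M|"
  using card_of_image ordLeq_transitive by blast

lemma card_of_range_countable_le:
  fixes f :: "'a::countable \<Rightarrow> 'b"
  assumes "infinite M"
  shows "|range f| \<le>o |M|"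
proof -
  have "|UNIV :: 'a set| \<le>o |UNIV :: nat set|"
    by (rule surj_imp_ordLeq[of _ "from_nat"]) simp
  moreover have "|UNIV :: nat set| \<le>o |M|"
    using assms by (simp add: infinite_iff_card_of_nat)
  ultimately show ?thesis
    using card_of_image_le ordLeq_transitive by blast
qed

lemma card_of_Un_le: "infinite M \<Longrightarrow> |A| \<le>o |M| \<Longrightarrow> |B| \<le>o |M| \<Longrightarrow> |A \<union> B| \<le>o |M|"
  by (rule card_of_Un_ordLeq_infinite_Field) (auto simp: Field_card_of card_of_Card_order card_of_card_order_on)

lemma card_of_image2_le:
  assumes "infinite M" "|A| \<le>o |M|" "|B| \<le>o |M|"
  shows "|(\<lambda>(a, b). f a b) ` (A \<times> B)| \<le>o |M|"
  by (rule card_of_image_le, rule card_of_Times_ordLeq_infinite_Field)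
    (use assms in \<open>auto simp: Field_card_of card_of_Card_order card_of_card_order_on\<close>)

lemma card_of_indexed_image_le:
  fixes f :: "'i::countable \<Rightarrow> 'a \<Rightarrow> 'b"
  assumes M: "infinite M" and A: "|A| \<le>o |M|"
  shows "|(\<Union>i. f i ` A)| \<le>o |M|"
proof -
  have "|UNIV :: 'i set| \<le>o |M|"
    using card_of_range_countable_le[OF M, of "\<lambda>x::'i. x"] by simp
  then show ?thesis
    using card_of_UNION_ordLeq_infinite[OF M, of UNIV "\<lambda>i. f i ` A"] card_of_image_le[OF A] by blast
qed

lemma card_of_Cl:
  assumes M: "infinite M" and F: "|F| \<le>o |M|"
  shows "|Cl F| \<le>o |M|"
proof -
  define G where "G A = A \<union> range (\<lambda>q x. of_rat q) \<union> range (\<lambda>i x. x i) \<union> (\<lambda>c x. of_real c) ` F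
      \<union> (\<lambda>(f, g). (\<lambda>x. f x + g x)) ` (A \<times> A) \<union> (\<lambda>(f, g). (\<lambda>x. f x * g x)) ` (A \<times> A)
      \<union> (\<lambda>f x. inverse (f x)) ` A \<union> (\<lambda>f x. cnj (f (\<lambda>i. cnj (x i)))) ` A
      \<union> (\<Union>l. (\<lambda>f x. f (sub l x)) ` A)
      \<union> (\<Union>p. (\<lambda>f x. case p of (c, r, m) \<Rightarrow>
            contour_integral (circlepath (of_rat c) (of_rat r)) (\<lambda>w. f (x(m := w)))) ` A)"
    for A :: "((nat \<Rightarrow> complex) \<Rightarrow> complex) set"
  have G: "|G A| \<le>o |M|" if "|A| \<le>o |M|" for A
    unfolding G_def
    by (intro card_of_Un_le card_of_image2_le card_of_image_le card_of_indexed_image_le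
        card_of_range_countable_le M F that)
  have Gn: "|(G ^^ n) {}| \<le>o |M|" for n
    by (induction n) (auto intro: G card_of_empty)
  have mono: "(G ^^ m) {} \<subseteq> (G ^^ n) {}" if "m \<le> n" for m n
    using that by (induction n rule: dec_induct) (auto simp: G_def)
  have step: "f \<in> (G ^^ Suc n) {}" if "f \<in> G ((G ^^ n) {})" for f n
    using that by simp
  have "\<exists>n. f \<in> (G ^^ n) {}" if "f \<in> Cl F" for f
    using that
  proof induction
    case (Cl_add f g)
    then obtain m n where "f \<in> (G ^^ m) {}" "g \<in> (G ^^ n) {}" by blast
    then have "f \<in> (G ^^ max m n) {}" "g \<in> (G ^^ max m n) {}" using mono by (meson max.cobounded1 max.cobounded2 subsetD)+
    then show ?case by (intro exI[of _ "Suc (max m n)"] step) (force simp: G_def)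
  next
    case (Cl_mult f g)
    then obtain m n where "f \<in> (G ^^ m) {}" "g \<in> (G ^^ n) {}" by blast
    then have "f \<in> (G ^^ max m n) {}" "g \<in> (G ^^ max m n) {}" using mono by (meson max.cobounded1 max.cobounded2 subsetD)+
    then show ?case by (intro exI[of _ "Suc (max m n)"] step) (force simp: G_def)
  next
    case (Cl_const c)
    then show ?case by (intro exI[of _ "Suc 0"] step) (simp add: G_def)
  next
    case (Cl_rat q)
    then show ?case by (intro exI[of _ "Suc 0"] step) (simp add: G_def)
  next
    case (Cl_var i)
    then show ?case by (intro exI[of _ "Suc 0"] step) (simp add: G_def)
  next
    case (Cl_inverse f)
    then obtain n where n: "f \<in> (G ^^ n) {}" by blast
    then show ?case by (intro exI[of _ "Suc n"] step) (simp add: G_def)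
  next
    case (Cl_cnj f)
    then obtain n where n: "f \<in> (G ^^ n) {}" by blast
    then show ?case by (intro exI[of _ "Suc n"] step) (simp add: G_def)
  next
    case (Cl_sub f l)
    then obtain n where n: "f \<in> (G ^^ n) {}" by blast
    then have "(\<lambda>x. f (sub l x)) \<in> (\<Union>l. (\<lambda>f x. f (sub l x)) ` (G ^^ n) {})" by blast
    then show ?case by (intro exI[of _ "Suc n"] step) (simp add: G_def)
  next
    case (Cl_contour f c r m)
    then obtain n where n: "f \<in> (G ^^ n) {}" by blast
    then have "(\<lambda>x. contour_integral (circlepath (of_rat c) (of_rat r)) (\<lambda>w. f (x(m := w))))
      \<in> (\<Union>p. (\<lambda>f x. case p of (c, r, m) \<Rightarrow>
            contour_integral (circlepath (of_rat c) (of_rat r)) (\<lambda>w. f (x(m := w)))) ` (G ^^ n) {})"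
      by (intro UN_I[of "(c, r, m)"]) auto
    then show ?case by (intro exI[of _ "Suc n"] step) (simp add: G_def)
  qed
  then have sub: "Cl F \<subseteq> (\<Union>n. (G ^^ n) {})" by blast
  have "|\<Union>n. (G ^^ n) {}| \<le>o |M|"
    using card_of_UNION_ordLeq_infinite[OF M, of "UNIV :: nat set" "\<lambda>n. (G ^^ n) {}"]
      Gn card_of_range_countable_le[OF M, of "\<lambda>x::nat. x"] by simp
  then show ?thesis
    using sub card_of_mono1 ordLeq_transitive by blast
qed

lemma length_act [simp]: "length (act l us) = length l"
  by (simp add: act_def)

lemma sub_emb: "sub l (emb us) = emb (act l us)"
  by (auto simp: sub_def emb_def act_def fun_eq_iff case_prod_unfold)

lemma sub_polydisc: "x \<in> polydisc cs e \<Longrightarrow> 0 < e \<Longrightarrow> sub l x \<in> polydisc (act l cs) e"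
  by (auto simp: polydisc_def sub_def act_def case_prod_unfold dist_norm)

lemma hol_sub:
  assumes "hol V f" "\<And>x. x \<in> U \<Longrightarrow> sub l x \<in> V"
  shows "hol U (\<lambda>x. f (sub l x))"
proof (rule hol_compose[OF assms(1) _ assms(2)])
  fix i show "hol U (\<lambda>x. sub l x i)"
    unfolding sub_def by (cases "i < length l") (auto intro: hol_add hol_const hol_var)
qed

lemma hol_sub_polydisc:
  "hol (polydisc (act l cs) e) f \<Longrightarrow> 0 < e \<Longrightarrow> hol (polydisc cs e) (\<lambda>x. f (sub l x))"
  by (rule hol_sub) (auto intro: sub_polydisc)

lemma emb_in_polydisc:
  "length us = length cs \<Longrightarrow> emb us \<in> polydisc cs e \<longleftrightarrow> (\<forall>i<length cs. \<bar>us ! i - cs ! i\<bar> < e)"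
  by (auto simp: polydisc_def emb_def dist_norm norm_of_real simp flip: of_real_diff)

lemma emb_center [simp]: "0 < e \<Longrightarrow> emb us \<in> polydisc us e"
  by (simp add: emb_in_polydisc)

lemma polydisc_mono: "e' \<le> e \<Longrightarrow> polydisc cs e' \<subseteq> polydisc cs e"
  by (fastforce simp: polydisc_def)

section \<open>Independent sets of reals\<close>

definition indep :: "real set \<Rightarrow> real set \<Rightarrow> bool" where
  "indep F T \<longleftrightarrow> (\<forall>f\<in>Cl F. \<forall>us cs e. distinct us \<longrightarrow> set us \<subseteq> T \<longrightarrow> length cs = length us \<longrightarrow> 0 < e \<longrightarrow>
     hol (polydisc cs e) f \<longrightarrow> emb us \<in> polydisc cs e \<longrightarrow> f (emb us) = 0 \<longrightarrow> (\<forall>x\<in>polydisc cs e. f x = 0))"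

definition represents :: "real set \<Rightarrow> real list \<Rightarrow> real \<Rightarrow> bool" where
  "represents F us b \<longleftrightarrow> (\<exists>f\<in>Cl F. \<exists>e>0. hol (polydisc us e) f \<and> f (emb us) = of_real b)"

lemma indepD:
  assumes "indep F T" "f \<in> Cl F" "distinct us" "set us \<subseteq> T" "length cs = length us" "0 < e"
    "hol (polydisc cs e) f" "emb us \<in> polydisc cs e" "f (emb us) = 0" "x \<in> polydisc cs e"
  shows "f x = 0"
  using assms unfolding indep_def by blast

text \<open>Identifying the variables at which \<open>us\<close> has equal entries reduces this to the definition.\<close>

lemma indep_transfer:
  assumes T: "indep F T" and f: "f \<in> Cl F" and us: "set us \<subseteq> T" and len: "length cs = length us"
    and hol: "hol (polydisc cs e) f" and e: "0 < e" and u: "emb us \<in> polydisc cs e" "f (emb us) = 0"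
    and x: "x \<in> polydisc cs e"
    and cs: "\<And>i j. i < length us \<Longrightarrow> j < length us \<Longrightarrow> us ! i = us ! j \<Longrightarrow> cs ! i = cs ! j"
    and xx: "\<And>i j. i < length us \<Longrightarrow> j < length us \<Longrightarrow> us ! i = us ! j \<Longrightarrow> x i = x j"
  shows "f x = 0"
proof -
  define vs where "vs = remdups us"
  have "\<exists>j<length vs. vs ! j = us ! i" if "i < length us" for i
    using that by (metis vs_def in_set_conv_nth nth_mem set_remdups)
  then obtain \<tau> where \<tau>: "\<And>i. i < length us \<Longrightarrow> \<tau> i < length vs \<and> vs ! (\<tau> i) = us ! i" by metis
  have "\<exists>i<length us. us ! i = vs ! j" if "j < length vs" for j
    using that by (metis vs_def in_set_conv_nth nth_mem set_remdups)
  then obtain \<sigma> where \<sigma>: "\<And>j. j < length vs \<Longrightarrow> \<sigma> j < length us \<and> us ! (\<sigma> j) = vs ! j" by metis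
  define l where "l = map (\<lambda>i. (0::rat, \<tau> i)) [0..<length us]"
  define ds where "ds = map (\<lambda>j. cs ! \<sigma> j) [0..<length vs]"
  define y where "y j = (if j < length vs then x (\<sigma> j) else 0)" for j
  have a1: "act l vs = us"
    using \<tau> by (intro nth_equalityI) (auto simp: act_def l_def)
  have a2: "act l ds = cs"
    using \<tau> \<sigma> by (intro nth_equalityI) (auto simp: act_def l_def ds_def len intro!: cs)
  have ux: "sub l y = x"
  proof
    fix i show "sub l y i = x i"
      using \<tau>[of i] \<sigma>[of "\<tau> i"] x len
      by (cases "i < length us") (auto simp: sub_def l_def y_def polydisc_def intro!: xx)
  qed
  have yd: "y \<in> polydisc ds e"
    using x \<sigma> by (auto simp: polydisc_def y_def ds_def len)
  have ud: "emb vs \<in> polydisc ds e"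
    using u(1) len \<sigma>[THEN conjunct1] by (auto simp: emb_in_polydisc ds_def simp flip: \<sigma>[THEN conjunct2])
  have "f (sub l y) = 0"
  proof (rule indepD[OF T Cl_sub[OF f, of l], where us = vs and cs = ds and e = e])
    show "hol (polydisc ds e) (\<lambda>x. f (sub l x))"
      using hol a2 e by (intro hol_sub_polydisc) auto
  qed (use us e u ud yd in \<open>auto simp: vs_def[symmetric] ds_def sub_emb a1, auto simp: vs_def\<close>)
  then show ?thesis by (simp add: ux)
qed

lemma represents_weaken:
  assumes "represents F us b" "set us \<subseteq> set vs"
  shows "represents F vs b"
proof -
  obtain f e where f: "f \<in> Cl F" "0 < e" "hol (polydisc us e) f" "f (emb us) = of_real b"
    using assms unfolding represents_def by blast
  have "\<exists>j<length vs. vs ! j = us ! i" if "i < length us" for i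
    using that assms(2) by (metis in_set_conv_nth nth_mem subsetD)
  then obtain \<tau> where \<tau>: "\<And>i. i < length us \<Longrightarrow> \<tau> i < length vs \<and> vs ! (\<tau> i) = us ! i" by metis
  define l where "l = map (\<lambda>i. (0::rat, \<tau> i)) [0..<length us]"
  have a1: "act l vs = us"
    using \<tau> by (intro nth_equalityI) (auto simp: act_def l_def)
  then show ?thesis unfolding represents_def
    using f by (intro bexI[OF _ Cl_sub[OF f(1), of l]] exI[of _ e]) (auto simp: sub_emb intro!: hol_sub_polydisc)
qed

lemma represents_translate:
  assumes "represents F us b"
  shows "represents F (map (\<lambda>t. t + of_rat (q t)) us) b"
proof -
  obtain f e where f: "f \<in> Cl F" "0 < e" "hol (polydisc us e) f" "f (emb us) = of_real b"
    using assms unfolding represents_def by blast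
  define l where "l = map (\<lambda>i. (- q (us ! i), i)) [0..<length us]"
  have a1: "act l (map (\<lambda>t. t + of_rat (q t)) us) = us"
    by (intro nth_equalityI) (auto simp: act_def l_def of_rat_minus)
  then show ?thesis unfolding represents_def
    using f by (intro bexI[OF _ Cl_sub[OF f(1), of l]] exI[of _ e]) (auto simp: sub_emb intro!: hol_sub_polydisc)
qed

lemma indep_translate_inj:
  assumes T: "indep F T"
  shows "inj_on (\<lambda>t. t + of_rat (q t)) T"
proof (rule inj_onI, rule ccontr)
  fix s t assume st: "s \<in> T" "t \<in> T" "s + of_rat (q s) = t + of_rat (q t)" "s \<noteq> t"
  define f :: "(nat \<Rightarrow> complex) \<Rightarrow> complex" where "f = (\<lambda>x. (x 0 + of_rat (-1) * x 1) + of_rat (q s - q t))"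
  have C: "f \<in> Cl F" unfolding f_def by (intro Cl_add Cl_mult Cl_var Cl_rat)
  have h: "hol U f" for U unfolding f_def by (intro hol_add hol_mult hol_var hol_const)
  have z: "f (emb [s, t]) = 0"
    using arg_cong[OF st(3), of complex_of_real]
    by (simp add: f_def emb_def of_rat_minus of_rat_diff algebra_simps)
  have "f (\<lambda>i. emb [s, t] i + (if i = 0 then 1 else 0)) = 0"
    using st by (intro indepD[OF T C _ _ _ _ h _ z, where cs = "[s,t]" and e = 2])
      (auto simp: polydisc_def emb_def less_Suc_eq dist_norm)
  moreover have "f (\<lambda>i. emb [s, t] i + (if i = 0 then 1 else 0)) = f (emb [s, t]) + 1"
    unfolding f_def by simp
  ultimately show False using z by simp
qed

lemma indep_translate:
  assumes T: "indep F T"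
  shows "indep F ((\<lambda>t. t + of_rat (q t)) ` T)"
  unfolding indep_def
proof (intro ballI allI impI)
  fix f us cs e x
  assume f: "f \<in> Cl F" and us: "distinct us" "set us \<subseteq> (\<lambda>t. t + of_rat (q t)) ` T"
    and len: "length cs = length us" and e: "0 < (e::real)" and hol: "hol (polydisc cs e) f"
    and u: "emb us \<in> polydisc cs e" "f (emb us) = 0" and x: "x \<in> polydisc cs e"
  have "\<forall>t\<in>set us. \<exists>s. s \<in> T \<and> s + of_rat (q s) = t"
    using us(2) by fastforce
  then obtain g where g: "\<And>t. t \<in> set us \<Longrightarrow> g t \<in> T \<and> g t + of_rat (q (g t)) = t"
    unfolding bchoice_iff by blast
  define vs where "vs = map g us"
  define l where "l = map (\<lambda>i. (q (vs ! i), i)) [0..<length us]"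
  define l' where "l' = map (\<lambda>i. (- q (vs ! i), i)) [0..<length us]"
  have a1: "act l vs = us"
    using g by (intro nth_equalityI) (auto simp: act_def l_def vs_def add.commute)
  have a2: "act l (act l' cs) = cs"
    using len by (intro nth_equalityI) (auto simp: act_def l_def l'_def of_rat_minus)
  have a3: "act l' us = vs"
    using g by (intro nth_equalityI) (auto simp: act_def l'_def vs_def of_rat_minus diff_eq_eq)
  have s: "sub l (sub l' x) = x"
    using x len by (auto simp: sub_def l_def l'_def polydisc_def fun_eq_iff of_rat_minus)
  have "f (sub l (sub l' x)) = 0"
  proof (rule indepD[OF T Cl_sub[OF f, of l], where us = vs and cs = "act l' cs" and e = e])
    show "hol (polydisc (act l' cs) e) (\<lambda>x. f (sub l x))"
      using hol a2 e by (intro hol_sub_polydisc) auto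
    have "inj_on g (set us)"
      by (rule inj_on_inverseI[of _ "\<lambda>s. s + of_rat (q s)"]) (simp add: g)
    then show "distinct vs" using us(1) by (simp add: vs_def distinct_map)
    show "set vs \<subseteq> T" using g by (auto simp: vs_def)
    show "emb vs \<in> polydisc (act l' cs) e"
      using sub_polydisc[OF u(1) e, of l'] by (simp add: sub_emb a3)
  qed (use e u a1 x in \<open>auto simp: sub_emb l'_def vs_def intro: sub_polydisc\<close>)
  then show "f x = 0" by (simp add: s)
qed

lemma indep_empty: "indep F {}"
proof -
  have "polydisc [] e = {emb []}" for e
    by (auto simp: polydisc_def emb_def)
  then show ?thesis unfolding indep_def by auto
qed

lemma maximal_indep_exists: "\<exists>T. indep F T \<and> (\<forall>T'. indep F T' \<longrightarrow> T \<subseteq> T' \<longrightarrow> T' = T)"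
proof -
  have "\<exists>T\<in>{T. indep F T}. \<forall>X\<in>{T. indep F T}. T \<subseteq> X \<longrightarrow> X = T"
  proof (rule subset_Zorn_nonempty)
    show "{T. indep F T} \<noteq> {}" using indep_empty by auto
  next
    fix \<C> assume ne: "\<C> \<noteq> {}" and ch: "subset.chain {T. indep F T} \<C>"
    have "indep F (\<Union>\<C>)"
      unfolding indep_def
    proof (intro ballI allI impI)
      fix f us cs e x
      assume f: "f \<in> Cl F" and us: "distinct us" "set us \<subseteq> \<Union>\<C>"
        and r: "length cs = length us" "0 < (e::real)" "hol (polydisc cs e) f"
         "emb us \<in> polydisc cs e" "f (emb us) = 0" "x \<in> polydisc cs e"
      obtain T where T: "T \<in> \<C>" "set us \<subseteq> T"
        using finite_subset_Union_chain[OF _ us(2) ne ch] by auto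
      then have "indep F T" using ch by (auto simp: subset.chain_def)
      then show "f x = 0" using indepD[OF _ f us(1) T(2) r] by blast
    qed
    then show "\<Union>\<C> \<in> {T. indep F T}" by simp
  qed
  then show ?thesis by blast
qed

section \<open>Zeros as quotients of contour integrals\<close>

lemma tendsto_fun_iff:
  fixes X :: "'a \<Rightarrow> 'i \<Rightarrow> 'b::topological_space"
  shows "(X \<longlongrightarrow> l) G \<longleftrightarrow> (\<forall>i. ((\<lambda>n. X n i) \<longlongrightarrow> l i) G)"
proof -
  have "limitin (product_topology (\<lambda>i::'i. euclidean :: 'b topology) UNIV) X l G \<longleftrightarrow> (\<forall>i. ((\<lambda>n. X n i) \<longlongrightarrow> l i) G)"
    by (simp add: limitin_componentwise)
  then show ?thesis
    by (simp add: euclidean_product_topology)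
qed

lemma polydisc_tube:
  fixes g :: "(nat \<Rightarrow> complex) \<Rightarrow> complex \<Rightarrow> complex"
  assumes g: "continuous_on (polydisc us e \<times> K) (\<lambda>p. g (fst p) (snd p))" and K: "compact K" and e: "0 < e"
    and nz: "\<And>w. w \<in> K \<Longrightarrow> g (emb us) w \<noteq> 0"
  obtains e' where "0 < e'" "e' \<le> e" "\<And>x w. x \<in> polydisc us e' \<Longrightarrow> w \<in> K \<Longrightarrow> g x w \<noteq> 0"
proof (rule ccontr)
  assume "\<not> thesis"
  then have "\<exists>x w. x \<in> polydisc us (e / (n + 1)) \<and> w \<in> K \<and> g x w = 0" for n :: nat
    using e that[of "e / (n + 1)"] by (force simp: field_simps)
  then obtain X W where X: "\<And>n::nat. X n \<in> polydisc us (e / real (n + 1))" and W: "\<And>n. W n \<in> K"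
    and z: "\<And>n. g (X n) (W n) = 0"
    by metis
  obtain w \<sigma> where w: "w \<in> K" and \<sigma>: "strict_mono (\<sigma> :: nat \<Rightarrow> nat)" and lim: "(W \<circ> \<sigma>) \<longlonglongrightarrow> w"
    using K W unfolding compact_def by blast
  have e0: "(\<lambda>n. e / (real n + 1)) \<longlonglongrightarrow> 0"
    using tendsto_mult[OF tendsto_const[of e] LIMSEQ_inverse_real_of_nat] by (simp add: divide_inverse add.commute)
  have "X \<longlonglongrightarrow> emb us"
    unfolding tendsto_fun_iff
  proof
    fix i
    show "(\<lambda>n. X n i) \<longlonglongrightarrow> emb us i"
    proof (cases "i < length us")
      case True
      show ?thesis
      proof (rule metric_tendsto_imp_tendsto[OF e0])
        show "\<forall>\<^sub>F n in sequentially. dist (X n i) (emb us i) \<le> dist (e / (real n + 1)) 0"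
        proof (rule always_eventually, rule allI)
          fix n
          have "dist (X n i) (emb us i) < e / (real n + 1)"
            using X[of n] True by (simp add: polydisc_def emb_def add.commute)
          then show "dist (X n i) (emb us i) \<le> dist (e / (real n + 1)) 0" using e by simp
        qed
      qed
    next
      case False
      then have "X n i = 0" for n using X[of n] by (simp add: polydisc_def)
      then show ?thesis using False by (simp add: emb_def)
    qed
  qed
  then have "(X \<circ> \<sigma>) \<longlonglongrightarrow> emb us"
    by (rule LIMSEQ_subseq_LIMSEQ[OF _ \<sigma>])
  then have "(\<lambda>n. ((X \<circ> \<sigma>) n, (W \<circ> \<sigma>) n)) \<longlonglongrightarrow> (emb us, w)"
    using lim by (rule tendsto_Pair)
  moreover have "X n \<in> polydisc us e" for n
    using X[of n] polydisc_mono[of "e / real (n + 1)" e us] e by (auto simp: field_simps)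
  ultimately have "(\<lambda>n. g (X (\<sigma> n)) (W (\<sigma> n))) \<longlonglongrightarrow> g (emb us) w"
    using continuous_on_tendsto_compose[OF g, of "\<lambda>n. ((X \<circ> \<sigma>) n, (W \<circ> \<sigma>) n)" "(emb us, w)" sequentially] W w e
    by simp
  then have "g (emb us) w = 0"
    by (simp add: z LIMSEQ_const_iff)
  then show False using nz w by blast
qed

lemma polydisc_nonzero_shrink:
  fixes g :: "(nat \<Rightarrow> complex) \<Rightarrow> complex"
  assumes g: "continuous_on (polydisc us e) g" and e: "0 < e" and nz: "g (emb us) \<noteq> 0"
  obtains e' where "0 < e'" "e' \<le> e" "\<And>x. x \<in> polydisc us e' \<Longrightarrow> g x \<noteq> 0"
proof -
  have "continuous_on (polydisc us e \<times> {0}) (\<lambda>p. g (fst p))"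
    by (rule continuous_on_compose2[OF g]) (auto intro: continuous_intros)
  then obtain e' where "0 < e'" "e' \<le> e" "\<And>x w. x \<in> polydisc us e' \<Longrightarrow> w \<in> {0} \<Longrightarrow> g x \<noteq> 0"
    by (rule polydisc_tube[of us e "{0}" "\<lambda>x w. g x"]) (use e nz in auto)
  then show thesis using that by blast
qed

lemma polydisc_recenter:
  assumes "emb us \<in> polydisc cs e" "length us = length cs" "0 < e"
  obtains e' where "0 < e'" "e' \<le> e" "polydisc us e' \<subseteq> polydisc cs e"
proof -
  have "\<exists>d>0. d \<le> e \<and> (\<forall>i<N. i < length cs \<longrightarrow> \<bar>us ! i - cs ! i\<bar> + d \<le> e)" for N
  proof (induction N)
    case (Suc N)
    then obtain d where d: "d > 0" "d \<le> e" "\<forall>i<N. i < length cs \<longrightarrow> \<bar>us ! i - cs ! i\<bar> + d \<le> e" by blast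
    show ?case
    proof (cases "N < length cs")
      case True
      then have "\<bar>us ! N - cs ! N\<bar> < e" using assms by (simp add: emb_in_polydisc)
      then show ?thesis using d
        by (intro exI[of _ "min d (e - \<bar>us ! N - cs ! N\<bar>)"]) (force simp: less_Suc_eq)
    next
      case False
      then show ?thesis using d by (intro exI[of _ d]) (auto simp: less_Suc_eq)
    qed
  qed (use assms in auto)
  then obtain d where d: "d > 0" "d \<le> e" "\<forall>i<length cs. \<bar>us ! i - cs ! i\<bar> + d \<le> e" by meson
  have "polydisc us d \<subseteq> polydisc cs e"
  proof
    fix x assume x: "x \<in> polydisc us d"
    have "dist (x i) (of_real (cs ! i)) < e" if "i < length cs" for i
    proof -
      have "dist (x i) (of_real (cs ! i)) \<le> dist (x i) (of_real (us ! i)) + dist (complex_of_real (us ! i)) (of_real (cs ! i))"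
        by (rule dist_triangle)
      moreover have "dist (complex_of_real (us ! i)) (of_real (cs ! i)) = \<bar>us ! i - cs ! i\<bar>"
        by (simp add: dist_norm flip: of_real_diff)
      moreover have "dist (x i) (of_real (us ! i)) < d" using x that assms by (simp add: polydisc_def)
      ultimately show ?thesis using d(3) that by force
    qed
    then show "x \<in> polydisc cs e" using x assms by (simp add: polydisc_def)
  qed
  then show thesis using that d by blast
qed

text \<open>\<open>G\<close> is \<open>2\<pi>\<i>\<close> times the derivative of \<open>f\<close>, so \<open>D\<close> and \<open>N\<close> are multiples of the integrals of
  \<open>f' / f\<close> and \<open>w f' / f\<close>.\<close>

lemma zero_by_contour_integrals:
  assumes g: "g holomorphic_on ball b \<rho>" and n: "0 < n"
    and f: "\<And>w. w \<in> ball b \<rho> \<Longrightarrow> f w = (w - b) ^ n * g w"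
    and nz: "\<And>w. w \<in> ball b \<rho> \<Longrightarrow> g w \<noteq> 0"
    and r: "0 < r" "r < R" "dist b c < r" "cball c R \<subseteq> ball b \<rho>"
  defines "G \<equiv> \<lambda>w. contour_integral (circlepath c R) (\<lambda>z. f z * inverse ((z - w) * (z - w)))"
  defines "D \<equiv> contour_integral (circlepath c r) (\<lambda>w. G w * inverse (f w))"
  defines "N \<equiv> contour_integral (circlepath c r) (\<lambda>w. w * (G w * inverse (f w)))"
  shows "D \<noteq> 0" "N = b * D"
proof -
  let ?p = "2 * of_real pi * \<i>"
  have holf: "f holomorphic_on ball b \<rho>"
    using g by (subst holomorphic_cong[OF refl f]) (auto intro!: holomorphic_intros)
  have sub: "cball c r \<subseteq> ball b \<rho>" "cball c r \<subseteq> ball c R"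
    using r by auto
  have bw: "b \<noteq> w" if "w \<in> sphere c r" for w
    using that r by (auto simp: dist_commute)
  have G: "G w = ?p * (of_nat n * (w - b) ^ (n - 1) * g w + (w - b) ^ n * deriv g w)" if w: "w \<in> sphere c r" for w
  proof -
    have wb: "w \<in> ball b \<rho>" "w \<in> ball c R" using w sub by auto
    have "(f has_field_derivative (1 / ?p * contour_integral (circlepath c R) (\<lambda>u. f u / (u - w)^2))) (at w)"
      using r by (intro Cauchy_derivative_integral_circlepath wb holomorphic_on_subset[OF holf]
          holomorphic_on_imp_continuous_on) auto
    moreover have "contour_integral (circlepath c R) (\<lambda>u. f u / (u - w)^2) = G w"
      unfolding G_def by (simp add: divide_inverse power2_eq_square)
    ultimately have 1: "(f has_field_derivative (1 / ?p * G w)) (at w)" by simp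
    have "((\<lambda>w. (w - b) ^ n * g w) has_field_derivative
        (of_nat n * (w - b) ^ (n - 1) * g w + (w - b) ^ n * deriv g w)) (at w)"
      using wb by (auto intro!: derivative_eq_intros holomorphic_derivI[OF g])
    then have "(f has_field_derivative
        (of_nat n * (w - b) ^ (n - 1) * g w + (w - b) ^ n * deriv g w)) (at w)"
      by (rule has_field_derivative_transform_within_open[of _ _ _ "ball b \<rho>"]) (use wb f in auto)
    from DERIV_unique[OF 1 this] show ?thesis by (simp add: field_simps)
  qed
  have Gf: "G w * inverse (f w) = ?p * (of_nat n * (1 / (w - b)) + deriv g w / g w)" if w: "w \<in> sphere c r" for w
  proof -
    have "w \<in> ball b \<rho>" using w sub by auto
    obtain k where k: "n = Suc k" using n by (cases n) auto
    define u where "u = w - b"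
    have "u \<noteq> 0" using bw[OF w] by (simp add: u_def)
    then show ?thesis
      using nz[OF \<open>w \<in> ball b \<rho>\<close>] unfolding G[OF w] f[OF \<open>w \<in> ball b \<rho>\<close>] k u_def[symmetric]
      by (simp add: field_simps)
  qed
  have gg: "(\<lambda>w. deriv g w / g w) holomorphic_on ball b \<rho>"
    using g nz by (auto intro!: holomorphic_intros)
  have p: "path_image (circlepath c r) = sphere c r" using r by simp
  have i1: "((\<lambda>w. 1 / (w - b)) has_contour_integral ?p * 1) (circlepath c r)"
    using r by (intro Cauchy_integral_circlepath_simple) (auto simp: dist_norm)
  have i2: "((\<lambda>w. w / (w - b)) has_contour_integral ?p * b) (circlepath c r)"
    using r by (intro Cauchy_integral_circlepath_simple) (auto simp: dist_norm)
  have i3: "((\<lambda>w. deriv g w / g w) has_contour_integral 0) (circlepath c r)"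
    using sub r by (intro Cauchy_theorem_disc_simple[OF gg]) auto
  have i4: "((\<lambda>w. w * (deriv g w / g w)) has_contour_integral 0) (circlepath c r)"
    using sub r by (intro Cauchy_theorem_disc_simple[of _ b \<rho>] holomorphic_intros gg) auto
  have "((\<lambda>w. ?p * (of_nat n * (1 / (w - b)) + deriv g w / g w)) has_contour_integral ?p * (of_nat n * (?p * 1) + 0)) (circlepath c r)"
    by (intro has_contour_integral_lmul has_contour_integral_add i1 i3)
  then have "((\<lambda>w. G w * inverse (f w)) has_contour_integral ?p * (of_nat n * (?p * 1) + 0)) (circlepath c r)"
    by (rule has_contour_integral_eq) (simp only: p Gf)
  then have D: "D = ?p * (of_nat n * (?p * 1) + 0)"
    unfolding D_def by (rule contour_integral_unique)
  have arith: "x * (q * (k * (1 / y) + z)) = q * (k * (x / y) + x * z)" for x q k y z :: complex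
    by (simp add: divide_inverse algebra_simps)
  have "((\<lambda>w. ?p * (of_nat n * (w / (w - b)) + w * (deriv g w / g w))) has_contour_integral ?p * (of_nat n * (?p * b) + 0)) (circlepath c r)"
    by (intro has_contour_integral_lmul has_contour_integral_add i2 i4)
  then have "((\<lambda>w. w * (G w * inverse (f w))) has_contour_integral ?p * (of_nat n * (?p * b) + 0)) (circlepath c r)"
    by (rule has_contour_integral_eq) (simp only: p Gf arith)
  then have N: "N = ?p * (of_nat n * (?p * b) + 0)"
    unfolding N_def by (rule contour_integral_unique)
  show "D \<noteq> 0" "N = b * D" using n unfolding D N by auto
qed

lemma holomorphic_zero_on_rationals:
  assumes h: "h holomorphic_on ball (complex_of_real c) e" and e: "0 < e"
    and z: "\<And>q. \<bar>of_rat q - c\<bar> < e \<Longrightarrow> h (of_rat q) = 0" and w: "w \<in> ball (of_real c) e"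
  shows "h w = 0"
proof (rule analytic_continuation[OF h, where U = "{of_rat q | q. \<bar>of_rat q - c\<bar> < e}" and \<xi> = "of_real c"])
  have dist: "dist (of_rat q) (complex_of_real c) = \<bar>of_rat q - c\<bar>" for q
    by (metis dist_norm norm_of_real of_real_diff of_real_of_rat_eq)
  show "{of_rat q | q. \<bar>of_rat q - c\<bar> < e} \<subseteq> ball (complex_of_real c) e"
    by (auto simp: dist_commute dist)
  show "complex_of_real c islimpt {of_rat q | q. \<bar>of_rat q - c\<bar> < e}"
    unfolding islimpt_approachable
  proof (intro allI impI)
    fix d :: real assume d: "0 < d"
    obtain q where q: "c < of_rat q" "of_rat q < c + min d e"
      using of_rat_dense[of c "c + min d e"] d e by auto
    then have "\<bar>of_rat q - c\<bar> < min d e" "of_rat q - c \<noteq> 0" by auto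
    then show "\<exists>x'\<in>{of_rat q | q. \<bar>of_rat q - c\<bar> < e}. x' \<noteq> complex_of_real c \<and> dist x' (complex_of_real c) < d"
      using dist[of q] by (intro bexI[of _ "of_rat q"]) auto
  qed
qed (use e w z in auto)

lemma emb_append: "emb (us @ [b]) = (emb us)(length us := of_real b)"
  by (auto simp: emb_def fun_eq_iff nth_append)

lemma sub_snoc:
  assumes "\<forall>i>n. x i = 0"
  shows "sub (map (\<lambda>i. (0, i)) [0..<n] @ [(q, j)]) x = x(n := of_rat q + x j)"
  using assms by (auto simp: sub_def fun_eq_iff nth_append)

lemma polydisc_snoc: "x \<in> polydisc (cs @ [c]) e \<longleftrightarrow> x(length cs := 0) \<in> polydisc cs e \<and> dist (x (length cs)) (of_real c) < e"
  by (auto simp: polydisc_def nth_append less_Suc_eq Suc_le_eq)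

lemma polydisc_snoc_upd: "x \<in> polydisc cs e \<Longrightarrow> dist w (of_real c) < e \<Longrightarrow> x(length cs := w) \<in> polydisc (cs @ [c]) e"
  by (auto simp: polydisc_def nth_append less_Suc_eq)

text \<open>Otherwise every rational value of the last variable gives a function of the remaining ones that
  vanishes at an independent point, hence identically, and \<open>f\<close> is 0 by density of the rationals.\<close>

lemma indep_not_zero_in_last:
  assumes T: "indep F T" and f: "f \<in> Cl F" and us: "distinct us" "set us \<subseteq> T" "length cs = length us"
    and hol: "hol (polydisc (cs @ [c]) e) f" and e: "0 < e" and u: "emb us \<in> polydisc cs e"
    and x0: "x0 \<in> polydisc (cs @ [c]) e" "f x0 \<noteq> 0"
  shows "\<exists>w\<in>ball (of_real c) e. f ((emb us)(length us := w)) \<noteq> 0"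
proof (rule ccontr)
  assume "\<not> ?thesis"
  then have z: "f ((emb us)(length us := w)) = 0" if "w \<in> ball (of_real c) e" for w using that by blast
  have dist: "dist (of_rat q) (complex_of_real c) = \<bar>of_rat q - c\<bar>" for q
    by (metis dist_norm norm_of_real of_real_diff of_real_of_rat_eq)
  let ?x = "x0(length us := 0)"
  have x: "?x \<in> polydisc cs e" "dist (x0 (length us)) (of_real c) < e"
    using x0 us(3) by (simp_all add: polydisc_snoc)
  have zq: "f (?x(length us := of_rat q)) = 0" if q: "\<bar>of_rat q - c\<bar> < e" for q
  proof -
    define l where "l = map (\<lambda>i. (0, i)) [0..<length us] @ [(q, length us)]"
    have s: "sub l x = x(length us := of_rat q)" if "x \<in> polydisc cs e" for x
      using that us(3) unfolding l_def by (subst sub_snoc) (auto simp: polydisc_def)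
    have "f (sub l ?x) = 0"
    proof (rule indepD[OF T Cl_sub[OF f] us e])
      show "hol (polydisc cs e) (\<lambda>x. f (sub l x))"
      proof (rule hol_sub[OF hol])
        fix x assume x: "x \<in> polydisc cs e"
        show "sub l x \<in> polydisc (cs @ [c]) e"
          using polydisc_snoc_upd[OF x, of "of_rat q" c] q us(3) by (simp add: s[OF x] dist)
      qed
      show "f (sub l (emb us)) = 0" using z q u by (simp add: s dist dist_commute)
    qed (use u x in auto)
    then show ?thesis using s[OF x(1)] by simp
  qed
  have hx: "(\<lambda>w. f (?x(length us := w))) holomorphic_on ball (of_real c) e"
  proof (rule hol_plot[OF hol])
    show "(\<lambda>w. (?x(length us := w)) i) holomorphic_on ball (of_real c) e" for i
      by (cases "i = length us") auto
    show "(\<lambda>w. ?x(length us := w)) ` ball (of_real c) e \<subseteq> polydisc (cs @ [c]) e"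
      using polydisc_snoc_upd[OF x(1)] us(3) by (auto simp: dist_commute)
  qed auto
  have "f (?x(length us := x0 (length us))) = 0"
    by (rule holomorphic_zero_on_rationals[of "\<lambda>w. f (?x(length us := w))", OF hx e zq])
      (use x(2) in \<open>simp_all add: dist_commute\<close>)
  then show False using x0 by simp
qed

lemma represents_root:
  assumes T: "indep F T" and f: "f \<in> Cl F" and us: "distinct us" "set us \<subseteq> T" "length cs = length us"
    and hol: "hol (polydisc (cs @ [c]) e) f" and e: "0 < e"
    and u: "emb (us @ [b]) \<in> polydisc (cs @ [c]) e" "f (emb (us @ [b])) = 0"
    and x0: "x0 \<in> polydisc (cs @ [c]) e" "f x0 \<noteq> 0"
  shows "represents F us b"
proof -
  note [simp del] = zero_less_of_rat_iff
  define M where "M = length us"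
  have [simp]: "length us = M" "length cs = M" by (simp_all add: M_def us)
  have u': "emb us \<in> polydisc cs e" "dist (complex_of_real b) (of_real c) < e"
    using u(1) polydisc_snoc[of "emb (us @ [b])" cs c e] 
    by (simp_all add: emb_append) (simp add: emb_def fun_upd_idem)
  define h where "h w = f ((emb us)(M := w))" for w
  have h: "h holomorphic_on ball (of_real c) e"
    unfolding h_def
  proof (rule hol_plot[OF hol])
    show "(\<lambda>w. ((emb us)(M := w)) i) holomorphic_on ball (of_real c) e" for i
      by (cases "i = M") auto
    show "(\<lambda>w. (emb us)(M := w)) ` ball (of_real c) e \<subseteq> polydisc (cs @ [c]) e"
      using polydisc_snoc_upd[OF u'(1)] by (auto simp: dist_commute)
  qed auto
  have hb: "h (of_real b) = 0" using u(2) by (simp add: h_def emb_append)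
  obtain w0 where w0: "w0 \<in> ball (complex_of_real c) e" "h w0 \<noteq> 0"
    using indep_not_zero_in_last[OF T f us hol e u'(1) x0] unfolding h_def M_def by blast
  have bS: "complex_of_real b \<in> ball (of_real c) e" using u'(2) by (simp add: dist_commute)
  have "\<not> h constant_on ball (of_real c) e"
    using w0 hb bS unfolding constant_on_def by metis
  from holomorphic_factor_zero_nonconstant[OF h open_ball connected_ball bS hb this]
  obtain g \<rho> n where n: "0 < n" and \<rho>: "0 < \<rho>" "ball (complex_of_real b) \<rho> \<subseteq> ball (of_real c) e"
    and g: "g holomorphic_on ball (complex_of_real b) \<rho>"
    and hg: "\<And>w. w \<in> ball (complex_of_real b) \<rho> \<Longrightarrow> h w = (w - of_real b) ^ n * g w"
    and gnz: "\<And>w. w \<in> ball (complex_of_real b) \<rho> \<Longrightarrow> g w \<noteq> 0"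
    by metis
  obtain r where r: "0 < (of_rat r :: real)" "of_rat r < \<rho> / 4"
  proof -
    have "0 < \<rho> / 4" using \<rho> by simp
    from of_rat_dense[OF this] show thesis using that by blast
  qed
  obtain s where s: "b < of_rat s" "of_rat s < b + of_rat r"
  proof -
    have "b < b + of_rat r" using r by simp
    from of_rat_dense[OF this] show thesis using that by blast
  qed
  let ?s = "of_rat s :: complex" and ?r = "of_rat r :: real" and ?R = "of_rat (2 * r) :: real"
  have R: "?R = 2 * ?r" by (simp add: of_rat_mult)
  have ds: "dist (complex_of_real b) ?s < ?r"
  proof -
    have "dist (complex_of_real b) ?s = \<bar>b - of_rat s\<bar>" 
      by (metis dist_norm norm_of_real of_real_diff of_real_of_rat_eq)
    then show ?thesis using s by simp
  qed
  have sub1: "cball ?s ?R \<subseteq> ball (complex_of_real b) \<rho>"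
  proof
    fix w assume "w \<in> cball ?s ?R"
    then have "dist (complex_of_real b) w \<le> dist (complex_of_real b) ?s + ?R"
      using dist_triangle[of "complex_of_real b" w ?s] by simp
    then show "w \<in> ball (complex_of_real b) \<rho>" using ds r R by simp
  qed
  have sph: "w \<in> cball ?s ?R" if "w \<in> sphere ?s ?r \<or> w \<in> sphere ?s ?R" for w
    using that r by (auto simp: R)
  have nz: "h w \<noteq> 0" if "w \<in> sphere ?s ?r" for w
  proof -
    have "w \<in> ball (complex_of_real b) \<rho>" using that sub1 sph by blast
    moreover have "w \<noteq> of_real b" using that ds by (auto simp: dist_commute)
    ultimately show ?thesis using hg gnz by simp
  qed
  have wc: "dist w (complex_of_real c) < e" if "w \<in> cball ?s ?R" for w
  proof -
    have "w \<in> ball (of_real c) e" using that sub1 \<rho>(2) by blast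
    then show ?thesis by (simp add: dist_commute)
  qed
  obtain e1 where e1: "0 < e1" "e1 \<le> e" "polydisc us e1 \<subseteq> polydisc cs e"
    using polydisc_recenter[OF u'(1) _ e] by auto
  have "continuous_on (polydisc us e1 \<times> sphere ?s ?r) (\<lambda>p. f ((fst p)(M := snd p)))"
  proof (rule continuous_on_compose2[OF hol_imp_continuous_on[OF hol]])
    show "continuous_on (polydisc us e1 \<times> sphere ?s ?r) (\<lambda>p. (fst p)(M := snd p))"
    proof (rule continuous_on_coordinatewise_then_product)
      fix i
      have "continuous_on (polydisc us e1 \<times> sphere ?s ?r) (\<lambda>p. fst p i)"
        by (rule continuous_on_compose2[OF continuous_on_product_coordinates[of i]]) (auto intro: continuous_intros)
      then show "continuous_on (polydisc us e1 \<times> sphere ?s ?r) (\<lambda>p. ((fst p)(M := snd p)) i)"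
        by (cases "i = M") (auto intro: continuous_intros)
    qed
    show "(\<lambda>p. (fst p)(M := snd p)) ` (polydisc us e1 \<times> sphere ?s ?r) \<subseteq> polydisc (cs @ [c]) e"
    proof clarify
      fix x w assume "x \<in> polydisc us e1" "w \<in> sphere ?s ?r"
      then show "(fst (x, w))(M := snd (x, w)) \<in> polydisc (cs @ [c]) e"
        using e1 polydisc_snoc_upd[of x cs e w c] wc[OF sph] by auto
    qed
  qed
  then obtain e2 where e2: "0 < e2" "e2 \<le> e1" 
    and nz2: "\<And>x w. x \<in> polydisc us e2 \<Longrightarrow> w \<in> sphere ?s ?r \<Longrightarrow> f (x(M := w)) \<noteq> 0"
    by (rule polydisc_tube[of us e1 "sphere ?s ?r" "\<lambda>x w. f (x(M := w))"]) (use e1 nz in \<open>auto simp: h_def\<close>)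
  define l where "l = map (\<lambda>i. (0 :: rat, i)) [0..<M] @ [(0, Suc M)]"
  define k where "k x = f (sub l x) * inverse ((x (Suc M) + of_rat (-1) * x M) * (x (Suc M) + of_rat (-1) * x M))" for x
  define G where "G x = contour_integral (circlepath ?s ?R) (\<lambda>z. k (x(Suc M := z)))" for x
  define D where "D x = contour_integral (circlepath ?s ?r) (\<lambda>w. (\<lambda>x. G x * inverse (f x)) (x(M := w)))" for x
  define N where "N x = contour_integral (circlepath ?s ?r) (\<lambda>w. (\<lambda>x. x M * (G x * inverse (f x))) (x(M := w)))" for x
  have d: "(\<lambda>x. x (Suc M) + of_rat (-1) * x M) \<in> Cl F"
    by (rule Cl_add[OF Cl_var Cl_mult[OF Cl_rat Cl_var]])
  have kC: "k \<in> Cl F"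
    unfolding k_def by (rule Cl_mult[OF Cl_sub[OF f] Cl_inverse[OF Cl_mult[OF d d]]])
  have GC: "G \<in> Cl F"
    unfolding G_def by (rule Cl_contour[OF kC])
  have Gf: "(\<lambda>x. G x * inverse (f x)) \<in> Cl F"
    by (rule Cl_mult[OF GC Cl_inverse[OF f]])
  have DC: "D \<in> Cl F"
    unfolding D_def by (rule Cl_contour[OF Gf])
  have NC: "N \<in> Cl F"
    unfolding N_def by (rule Cl_contour[OF Cl_mult[OF Cl_var Gf]])
  define V where "V = {x(M := w) | x w. x \<in> polydisc us e2 \<and> w \<in> sphere ?s ?r}"
  define V1 where "V1 = {x(M := w, Suc M := z) | x w z. x \<in> polydisc us e2 \<and> w \<in> sphere ?s ?r \<and> z \<in> sphere ?s ?R}"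
  have sl: "sub l (x(M := w, Suc M := z)) = x(M := z)" if "x \<in> polydisc us e2" for x w z
  proof -
    have "x i = 0" if "i > M" for i using that \<open>x \<in> polydisc us e2\<close> by (simp add: polydisc_def)
    then show ?thesis
      by (auto simp: sub_def l_def nth_append fun_eq_iff less_Suc_eq)
  qed
  have in_disc: "x(M := z) \<in> polydisc (cs @ [c]) e" if "x \<in> polydisc us e2" "z \<in> cball ?s ?R" for x z
  proof -
    have "x \<in> polydisc cs e" using that e1 e2 polydisc_mono[of e2 e1 us] by auto
    then show ?thesis using polydisc_snoc_upd[of x cs e z c] wc[OF that(2)] by simp
  qed
  have "hol V1 k" 
    unfolding k_def
  proof (intro hol_mult hol_inverse hol_add hol_var hol_const)
    show "hol V1 (\<lambda>x. f (sub l x))"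
      by (rule hol_sub[OF hol]) (auto simp only: V1_def sl mem_Collect_eq intro!: in_disc sph)
    fix x assume "x \<in> V1"
    then obtain y w z where x: "x = y(M := w, Suc M := z)" "dist ?s w = ?r" "dist ?s z = ?R"
      unfolding V1_def by auto
    then have "w \<noteq> z" using r R by auto
    then show "(x (Suc M) + of_rat (-1) * x M) * (x (Suc M) + of_rat (-1) * x M) \<noteq> 0"
      by (simp add: x of_rat_minus)
  qed
  then have "hol V G"
    unfolding G_def by (rule hol_contour_integral) (use r R in \<open>auto simp: V_def V1_def\<close>)
  moreover have "hol V (\<lambda>x. inverse (f x))"
  proof (rule hol_inverse)
    show "hol V f" by (rule hol_subset[OF hol]) (auto simp only: V_def mem_Collect_eq intro!: in_disc sph)
    show "f x \<noteq> 0" if "x \<in> V" for x using that nz2 by (auto simp: V_def)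
  qed
  ultimately have hG: "hol V (\<lambda>x. G x * inverse (f x))" by (rule hol_mult)
  have hD: "hol (polydisc us e2) D"
    unfolding D_def by (rule hol_contour_integral[OF hG]) (use r in \<open>auto simp: V_def\<close>)
  have hN: "hol (polydisc us e2) N"
    unfolding N_def by (rule hol_contour_integral[OF hol_mult[OF hol_var hG]]) (use r in \<open>auto simp: V_def\<close>)
  have Gval: "G ((emb us)(M := w)) = contour_integral (circlepath ?s ?R) (\<lambda>z. h z * inverse ((z - w) * (z - w)))" for w
    unfolding G_def k_def using e2 by (simp add: sl h_def of_rat_minus)
  have Dval: "D (emb us) \<noteq> 0" and Nval: "N (emb us) = of_real b * D (emb us)"
    using zero_by_contour_integrals[OF g n hg gnz _ _ ds sub1] r R
    unfolding D_def N_def Gval h_def[symmetric] by simp_all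
  obtain e3 where e3: "0 < e3" "e3 \<le> e2" "\<And>x. x \<in> polydisc us e3 \<Longrightarrow> D x \<noteq> 0"
    using polydisc_nonzero_shrink[OF hol_imp_continuous_on[OF hD] e2(1) Dval] by metis
  show ?thesis
    unfolding represents_def
  proof (intro bexI exI conjI)
    show "(\<lambda>x. N x * inverse (D x)) \<in> Cl F" by (rule Cl_mult[OF NC Cl_inverse[OF DC]])
    show "0 < e3" by fact
    show "hol (polydisc us e3) (\<lambda>x. N x * inverse (D x))"
      using e3 polydisc_mono[OF e3(2)] by (intro hol_mult hol_inverse hol_subset[OF hN] hol_subset[OF hD])
    show "N (emb us) * inverse (D (emb us)) = of_real b" using Dval Nval by simp
  qed
qed

lemma maximal_indep_represents:
  assumes T: "indep F T" and max: "\<And>T'. indep F T' \<Longrightarrow> T \<subseteq> T' \<Longrightarrow> T' = T"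
  shows "\<exists>us. distinct us \<and> set us \<subseteq> T \<and> represents F us b"
proof (cases "b \<in> T")
  case True
  have "represents F [b] b"
    unfolding represents_def
    by (rule bexI[OF _ Cl_var[of 0]]) (auto simp: emb_def intro!: exI[of _ 1] hol_var)
  then show ?thesis using True by (intro exI[of _ "[b]"]) auto
next
  case False
  then have "\<not> indep F (insert b T)" using max[of "insert b T"] by auto
  then obtain f us cs e x where f: "f \<in> Cl F" and us: "distinct us" "set us \<subseteq> insert b T"
    and len: "length cs = length us" and e: "0 < (e::real)" and hol: "hol (polydisc cs e) f"
    and u: "emb us \<in> polydisc cs e" "f (emb us) = 0" and x: "x \<in> polydisc cs e" "f x \<noteq> 0"
    unfolding indep_def by blast
  have "b \<in> set us"
  proof (rule ccontr)
    assume "b \<notin> set us"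
    then have "set us \<subseteq> T" using us by auto
    then show False using indepD[OF T f us(1) _ len e hol u x(1)] x(2) by blast
  qed
  then obtain a where a: "a < length us" "us ! a = b" by (auto simp: in_set_conv_nth)
  define M where "M = length us - 1"
  have M: "length us = Suc M" "length cs = Suc M" using a len by (auto simp: M_def)
  define \<tau> where "\<tau> = Transposition.transpose a M"
  define l where "l = map (\<lambda>i. (0::rat, \<tau> i)) [0..<Suc M]"
  have \<tau>: "\<tau> i < Suc M" if "i < Suc M" for i using that a M by (auto simp: \<tau>_def Transposition.transpose_def)
  have \<tau>\<tau>: "\<tau> (\<tau> i) = i" for i by (simp add: \<tau>_def)
  have act: "act l xs = xs[a := xs ! M, M := xs ! a]" if "length xs = Suc M" for xs
    using that \<tau> a M by (intro nth_equalityI) (auto simp: act_def l_def \<tau>_def Transposition.transpose_def nth_list_update nth_append)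
  have actact: "act l (act l xs) = xs" if "length xs = Suc M" for xs
    using that \<tau> \<tau>\<tau> by (intro nth_equalityI) (auto simp: act_def l_def simp del: upt_Suc)
  have ss: "sub l (sub l y) = y" if "y \<in> polydisc cs e" for y
    using that \<tau> \<tau>\<tau> M by (auto simp: sub_def l_def polydisc_def fun_eq_iff simp del: upt_Suc)
  have snoc: "\<exists>vs v. xs = vs @ [v] \<and> length vs = M" if "length xs = Suc M" for xs :: "real list"
    using that by (metis length_Suc_conv_rev)
  obtain ds d where ds: "act l cs = ds @ [d]" "length ds = M" using snoc[of "act l cs"] by (auto simp: l_def)
  obtain vs v where vs: "act l us = vs @ [v]" "length vs = M" using snoc[of "act l us"] by (auto simp: l_def)
  have "v = act l us ! M" using vs by (simp add: nth_append)
  also have "\<dots> = b" using a M by (simp add: act nth_list_update)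
  finally have [simp]: "v = b" .
  have dist: "distinct (vs @ [b])" and set: "set (vs @ [b]) = set us"
    using us(1) a(1) M act[OF M(1)] vs(1) \<open>v = b\<close> by (metis distinct_swap lessI, metis set_swap lessI)
  have vT: "set vs \<subseteq> T" using dist set us(2) by auto
  have "represents F vs b"
  proof (rule represents_root[OF T Cl_sub[OF f, of l]])
    show "hol (polydisc (ds @ [d]) e) (\<lambda>x. f (sub l x))"
      using hol e actact[of cs] M by (intro hol_sub_polydisc) (auto simp: ds[symmetric])
    show "emb (vs @ [b]) \<in> polydisc (ds @ [d]) e"
      using sub_polydisc[OF u(1) e, of l] vs ds by (simp add: sub_emb)
    show "f (sub l (emb (vs @ [b]))) = 0"
      using vs(1)[symmetric] actact[of us] M u by (simp add: sub_emb)
    show "sub l x \<in> polydisc (ds @ [d]) e"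
      using sub_polydisc[OF x(1) e, of l] ds by simp
    show "f (sub l (sub l x)) \<noteq> 0" using x ss by simp
  qed (use vT dist ds vs e in auto)
  then show ?thesis using dist vT by auto
qed

section \<open>Polynomials and template hypergraphs\<close>

inductive poly_over :: "real set \<Rightarrow> nat \<Rightarrow> ((nat \<Rightarrow> real) \<Rightarrow> real) \<Rightarrow> bool" for F N where
  "c \<in> F \<Longrightarrow> poly_over F N (\<lambda>x. c)"
| "i < N \<Longrightarrow> poly_over F N (\<lambda>x. x i)"
| "poly_over F N p \<Longrightarrow> poly_over F N q \<Longrightarrow> poly_over F N (\<lambda>x. p x + q x)"
| "poly_over F N p \<Longrightarrow> poly_over F N q \<Longrightarrow> poly_over F N (\<lambda>x. p x * q x)"

lemma poly_over_mono: "poly_over F N p \<Longrightarrow> F \<subseteq> G \<Longrightarrow> poly_over G N p"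
  by (induction rule: poly_over.induct) (auto intro: poly_over.intros)

lemma poly_fun_imp_poly_over:
  assumes "poly_fun N p"
  shows "\<exists>F. finite F \<and> poly_over F N p"
  using assms
proof induction
  case (pconst c)
  show ?case by (intro exI[of _ "{c}"]) (auto intro: poly_over.intros(1))
next
  case (pvar i)
  then show ?case by (auto intro: poly_over.intros(2))
next
  case (padd p q)
  then obtain F G where "finite F" "finite G" "poly_over (F \<union> G) N p" "poly_over (F \<union> G) N q"
    using poly_over_mono by (metis Un_upper1 Un_upper2)
  then show ?case by (intro exI[of _ "F \<union> G"]) (auto intro: poly_over.intros(3))
next
  case (pmult p q)
  then obtain F G where "finite F" "finite G" "poly_over (F \<union> G) N p" "poly_over (F \<union> G) N q"
    using poly_over_mono by (metis Un_upper1 Un_upper2)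
  then show ?case by (intro exI[of _ "F \<union> G"]) (auto intro: poly_over.intros(4))
qed

definition complexifies ::
    "real set \<Rightarrow> nat \<Rightarrow> ((nat \<Rightarrow> real) \<Rightarrow> real) \<Rightarrow> ((nat \<Rightarrow> complex) \<Rightarrow> complex) \<Rightarrow> bool" where
  "complexifies F N p P \<longleftrightarrow>
    (\<forall>x y. (\<forall>v<N. x v = of_real (y v)) \<longrightarrow> P x = of_real (p y)) \<and>
    (\<forall>\<psi>. (\<forall>v<N. \<psi> v \<in> Cl F) \<longrightarrow> (\<lambda>x. P (\<lambda>v. \<psi> v x)) \<in> Cl F) \<and>
    (\<forall>\<psi> U. (\<forall>v<N. hol U (\<psi> v)) \<longrightarrow> hol U (\<lambda>x. P (\<lambda>v. \<psi> v x)))"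

lemma complexifies_add:
  "complexifies F N p P \<Longrightarrow> complexifies F N q Q \<Longrightarrow> complexifies F N (\<lambda>x. p x + q x) (\<lambda>x. P x + Q x)"
  unfolding complexifies_def by (intro conjI allI impI Cl_add hol_add) (metis of_real_add, blast+)

lemma complexifies_mult:
  "complexifies F N p P \<Longrightarrow> complexifies F N q Q \<Longrightarrow> complexifies F N (\<lambda>x. p x * q x) (\<lambda>x. P x * Q x)"
  unfolding complexifies_def by (intro conjI allI impI Cl_mult hol_mult) (metis of_real_mult, blast+)

lemma poly_over_complexifies:
  assumes "poly_over F N p"
  shows "\<exists>P. complexifies F N p P"
  using assms
proof induction
  case (1 c)
  then show ?case
    by (intro exI[of _ "\<lambda>x. of_real c"]) (auto simp: complexifies_def intro: Cl_const hol_const)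
next
  case (2 i)
  then show ?case by (intro exI[of _ "\<lambda>x. x i"]) (auto simp: complexifies_def)
qed (blast intro: complexifies_add complexifies_mult)+

lemma poly_fun_sum: "finite S \<Longrightarrow> (\<And>s. s \<in> S \<Longrightarrow> poly_fun N (p s)) \<Longrightarrow> poly_fun N (\<lambda>x. \<Sum>s\<in>S. p s x)"
  by (induction S rule: finite_induct) (auto intro: poly_fun.intros)

lemma poly_fun_prod: "finite S \<Longrightarrow> (\<And>s. s \<in> S \<Longrightarrow> poly_fun N (p s)) \<Longrightarrow> poly_fun N (\<lambda>x. \<Prod>s\<in>S. p s x)"
  by (induction S rule: finite_induct) (auto intro: poly_fun.intros)

lemma poly_fun_diff_square:
  assumes "i < N" "j < N"
  shows "poly_fun N (\<lambda>x. (x i - x j)\<^sup>2)"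
proof -
  have "poly_fun N (\<lambda>x. (x i + (-1) * x j) * (x i + (-1) * x j))"
    using assms by (intro poly_fun.intros)
  then show ?thesis by (simp add: power2_eq_square)
qed

lemma index_less: "i < k \<Longrightarrow> c < d \<Longrightarrow> i * d + c < k * (d :: nat)"
  by (metis add.commute add_less_cancel_left less_le_trans mult.commute mult_Suc_right mult_le_mono2 Suc_leI)

text \<open>There are only finitely many patterns of coordinate coincidences among \<open>k\<close> points, and each of them
  is the zero set of a sum of squares of differences of coordinates.\<close>

lemma algebraic_hg_L_edges:
  assumes \<P>: "\<And>P. P \<in> \<P> \<Longrightarrow> template d k P"
  shows "algebraic_hg d k (L_edges d k \<P>)"
proof -
  define pat where "pat h = {(i, j, c). i < k \<and> j < k \<and> c < d \<and> h i ! c = h j ! c}" for h :: "nat \<Rightarrow> nat list"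
  define \<S> where "\<S> = {pat h | h P. P \<in> \<P> \<and> bij_betw h {..<k} P}"
  have pat_sub: "pat h \<subseteq> {..<k} \<times> {..<k} \<times> {..<d}" for h by (auto simp: pat_def)
  have fin_pat: "finite (pat h)" for h by (rule finite_subset[OF pat_sub]) auto
  have fin: "finite \<S>"
    by (rule finite_subset[of _ "Pow ({..<k} \<times> {..<k} \<times> {..<d})"]) (use pat_sub in \<open>auto simp: \<S>_def\<close>)
  define p where "p x = (\<Prod>S\<in>\<S>. \<Sum>(i, j, c)\<in>S. (x (i * d + c) - x (j * d + c))\<^sup>2)" for x :: "nat \<Rightarrow> real"
  have poly: "poly_fun (k * d) p"
    unfolding p_def
  proof (intro poly_fun_prod fin)
    fix S assume "S \<in> \<S>"
    then obtain h where S: "S = pat h" unfolding \<S>_def mem_Collect_eq by metis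
    show "poly_fun (k * d) (\<lambda>x. \<Sum>(i, j, c)\<in>S. (x (i * d + c) - x (j * d + c))\<^sup>2)"
      unfolding S case_prod_unfold
      by (intro poly_fun_sum fin_pat poly_fun_diff_square index_less) (auto simp: pat_def)
  qed
  have zero: "p (\<lambda>v. a (v div d) ! (v mod d)) = 0 \<longleftrightarrow> (\<exists>S\<in>\<S>. \<forall>(i, j, c)\<in>S. a i ! c = a j ! c)"
    for a :: "nat \<Rightarrow> real list"
  proof -
    have "(\<Sum>(i, j, c)\<in>S. (a ((i * d + c) div d) ! ((i * d + c) mod d) - a ((j * d + c) div d) ! ((j * d + c) mod d))\<^sup>2) = 0
       \<longleftrightarrow> (\<forall>(i, j, c)\<in>S. a i ! c = a j ! c)" if S0: "S \<in> \<S>" for S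
    proof -
      obtain h where S: "S = pat h" using S0 unfolding \<S>_def mem_Collect_eq by metis
      show ?thesis
        unfolding S by (subst sum_nonneg_eq_0_iff[OF fin_pat]) (auto simp: pat_def)
    qed
    then show ?thesis
      unfolding p_def by (auto simp: prod_zero_iff[OF fin])
  qed
  have "(\<exists>P\<in>\<P>. hom_image d P e) \<longleftrightarrow> (\<exists>a. bij_betw a {..<k} e \<and> p (\<lambda>v. a (v div d) ! (v mod d)) = 0)"
    (is "?l \<longleftrightarrow> ?r") if e: "e \<in> nsets (Rn d) k" for e
  proof
    assume ?l
    then obtain P f where P: "P \<in> \<P>" and f: "f ` P \<subseteq> e" "inj_on f P"
      and hom: "\<And>x y i. x \<in> P \<Longrightarrow> y \<in> P \<Longrightarrow> i < d \<Longrightarrow> x ! i = y ! i \<Longrightarrow> f x ! i = f y ! i"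
      unfolding hom_image_def template_hom_def by blast
    have card: "finite P" "card P = k" "finite e" "card e = k" using \<P>[OF P] e by (auto simp: template_def nsets_def)
    then obtain h where h: "bij_betw h {..<k} P" using ex_bij_betw_nat_finite[of P] by (auto simp: lessThan_atLeast0)
    have "f ` P = e" using card f by (metis card_image card_subset_eq)
    then have "bij_betw (f \<circ> h) {..<k} e" using f(2) h by (intro bij_betw_trans[OF h]) (simp add: bij_betw_def)
    moreover have "pat h \<in> \<S>" using P h by (auto simp: \<S>_def)
    moreover have "\<forall>(i, j, c)\<in>pat h. (f \<circ> h) i ! c = (f \<circ> h) j ! c"
      using h by (auto simp: pat_def bij_betw_def intro!: hom)
    ultimately show ?r unfolding zero by blast
  next
    assume ?r
    then obtain a P h where a: "bij_betw a {..<k} e" and P: "P \<in> \<P>" and h: "bij_betw h {..<k} P"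
      and eq: "\<forall>(i, j, c)\<in>pat h. a i ! c = a j ! c"
      unfolding zero \<S>_def by auto
    let ?f = "a \<circ> inv_into {..<k} h"
    have "bij_betw ?f P e" using a h bij_betw_inv_into bij_betw_trans by blast
    moreover have "?f x ! i = ?f y ! i" if "x \<in> P" "y \<in> P" "i < d" "x ! i = y ! i" for x y i
    proof -
      have "(inv_into {..<k} h x, inv_into {..<k} h y, i) \<in> pat h"
        using that h by (auto simp: pat_def bij_betw_def f_inv_into_f inv_into_into[of _ h "{..<k}", simplified])
      then show ?thesis using eq by auto
    qed
    ultimately show ?l using P unfolding hom_image_def template_hom_def bij_betw_def by blast
  qed
  then show ?thesis
    unfolding algebraic_hg_def L_edges_def using poly by (intro exI[of _ p]) auto
qed

lemma template_homD:
  assumes "template_hom d f P Q"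
  shows "f ` P \<subseteq> Q" "inj_on f P"
    and "x \<in> P \<Longrightarrow> y \<in> P \<Longrightarrow> i < d \<Longrightarrow> x ! i = y ! i \<Longrightarrow> f x ! i = f y ! i"
proof -
  show "f ` P \<subseteq> Q" "inj_on f P"
    using assms by (simp_all only: template_hom_def)
  have "\<forall>x\<in>P. \<forall>y\<in>P. \<forall>i<d. x ! i = y ! i \<longrightarrow> f x ! i = f y ! i"
    using assms unfolding template_hom_def by (elim conjE)
  then show "f x ! i = f y ! i" if "x \<in> P" "y \<in> P" "i < d" "x ! i = y ! i"
    using that by metis
qed

lemma hom_image_trans:
  assumes "hom_image d P Q" "hom_image d Q R" 
  shows "hom_image d P R"
proof -
  obtain f where f: "template_hom d f P Q" using assms(1) unfolding hom_image_def by (rule exE)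
  obtain g where g: "template_hom d g Q R" using assms(2) unfolding hom_image_def by (rule exE)
  note f = template_homD[OF f] and g = template_homD[OF g]
  have "template_hom d (g \<circ> f) P R"
    unfolding template_hom_def
  proof (intro conjI ballI allI impI)
    show "(g \<circ> f) ` P \<subseteq> R" using f(1) g(1) by auto
    show "inj_on (g \<circ> f) P"
      by (rule comp_inj_on[OF f(2) inj_on_subset[OF g(2) f(1)]])
    fix x y i assume xy: "x \<in> P" "y \<in> P" "i < d" "x ! i = y ! i"
    have "g (f x) ! i = g (f y) ! i"
      by (rule g(3)[OF _ _ xy(3) f(3)[OF xy]]) (use f(1) xy in blast)+
    then show "(g \<circ> f) x ! i = (g \<circ> f) y ! i" by simp
  qed
  then show ?thesis unfolding hom_image_def by (rule exI[of _ "g \<circ> f"])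
qed

lemma hom_image_map:
  assumes "\<forall>x\<in>P. length x = d" "inj_on h (\<Union>(set ` P))"
  shows "hom_image d P (map h ` P)"
proof -
  have "inj_on (map h) P"
    using assms(2) by (rule inj_on_mapI)
  then show ?thesis
    unfolding hom_image_def template_hom_def using assms by (intro exI[of _ "map h"]) auto
qed

lemma hom_closed_eq_L_edges:
  assumes E: "E \<subseteq> nsets (Rn d) k"
    and closed: "\<And>Q Q'. Q \<in> E \<Longrightarrow> Q' \<in> nsets (Rn d) k \<Longrightarrow> hom_image d Q Q' \<Longrightarrow> Q' \<in> E"
  shows "\<exists>\<P>. (\<forall>P\<in>\<P>. template d k P) \<and> L_edges d k \<P> = E"
proof (intro exI conjI)
  let ?\<P> = "{P. template d k P \<and> (\<forall>Q\<in>nsets (Rn d) k. hom_image d P Q \<longrightarrow> Q \<in> E)}"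
  show "\<forall>P\<in>?\<P>. template d k P" by blast
  show "L_edges d k ?\<P> = E"
  proof
    show "L_edges d k ?\<P> \<subseteq> E" unfolding L_edges_def by blast
    show "E \<subseteq> L_edges d k ?\<P>"
    proof
      fix Q assume Q: "Q \<in> E"
      then have Qn: "Q \<in> nsets (Rn d) k" using E by blast
      then have Q': "finite Q" "card Q = k" "\<forall>x\<in>Q. length x = d" by (auto simp: nsets_def Rn_def)
      obtain h :: "real \<Rightarrow> nat" where h: "inj_on h (\<Union>(set ` Q))"
        using finite_imp_inj_to_nat_seg[of "\<Union>(set ` Q)"] Q'(1) by auto
      let ?P = "map h ` Q" and ?i = "inv_into (\<Union>(set ` Q)) h"
      have QP: "hom_image d Q ?P" using Q' h by (intro hom_image_map)
      have ii: "map ?i (map h x) = x" if "x \<in> Q" for x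
        using that h by (auto intro!: map_idI inv_into_f_f)
      have "inj_on (map h) Q" by (rule inj_on_inverseI[of _ "map ?i"]) (rule ii)
      then have tP: "template d k ?P" using Q' by (auto simp: template_def card_image)
      have "inj_on ?i (\<Union>(set ` ?P))"
        by (rule inj_on_subset[OF inj_on_inv_into[of _ h "\<Union>(set ` Q)"]]) auto
      then have "hom_image d ?P (map ?i ` ?P)" using Q' by (intro hom_image_map) auto
      moreover have "map ?i ` ?P = Q" using ii by (force simp: image_image)
      ultimately have PQ: "hom_image d ?P Q" by simp
      have "?P \<in> ?\<P>"
        using tP closed[OF Q] hom_image_trans[OF QP] by blast
      then show "Q \<in> L_edges d k ?\<P>"
        using Qn PQ unfolding L_edges_def by blast
    qed
  qed
qed

section \<open>An independent generating set that meets every interval in continuum many points\<close>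

lemma card_of_lists_le:
  assumes M: "infinite M" and A: "|A| \<le>o |M|"
  shows "|lists A| \<le>o |M|"
proof -
  have "|{xs. xs \<in> lists A \<and> length xs = n}| \<le>o |M|" for n
  proof (induction n)
    case 0
    have "{xs. xs \<in> lists A \<and> length xs = 0} = (\<lambda>_::nat. []) ` UNIV" by auto
    then show ?case using card_of_range_countable_le[OF M, of "\<lambda>_::nat. []"] by simp
  next
    case (Suc n)
    have "{xs. xs \<in> lists A \<and> length xs = Suc n} = (\<lambda>(x, xs). x # xs) ` (A \<times> {xs. xs \<in> lists A \<and> length xs = n})"
      by (auto simp: length_Suc_conv image_iff)
    then show ?case using card_of_image2_le[OF M A Suc, of "(#)"] by simp
  qed
  moreover have "|UNIV :: nat set| \<le>o |M|"
    using card_of_range_countable_le[OF M, of "\<lambda>x::nat. x"] by simp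
  moreover have "lists A = (\<Union>n. {xs. xs \<in> lists A \<and> length xs = n})" by auto
  ultimately show ?thesis
    using card_of_UNION_ordLeq_infinite[OF M, of "UNIV :: nat set" "\<lambda>n. {xs. xs \<in> lists A \<and> length xs = n}"] by simp
qed

lemma card_of_represented:
  assumes M: "infinite M" and F: "|F| \<le>o |M|" and T: "|T| \<le>o |M|"
    and rep: "\<And>b. \<exists>us. set us \<subseteq> T \<and> represents F us b"
  shows "|UNIV :: real set| \<le>o |M|"
proof -
  have "UNIV = (\<lambda>(f, us). Re (f (emb us))) ` (Cl F \<times> lists T)"
  proof (intro UNIV_eq_I)
    fix b
    obtain us f where "set us \<subseteq> T" "f \<in> Cl F" "f (emb us) = of_real b"
      using rep[of b] unfolding represents_def by blast
    then show "b \<in> (\<lambda>(f, us). Re (f (emb us))) ` (Cl F \<times> lists T)"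
      by (intro image_eqI[of _ _ "(f, us)"]) auto
  qed
  then show ?thesis
    using card_of_image2_le[OF M card_of_Cl[OF M F] card_of_lists_le[OF M T], of "\<lambda>f us. Re (f (emb us))"] by simp
qed

text \<open>A maximal independent set is divided into countably many parts of the size of the continuum, one for
  each pair of rationals \<open>a < b\<close>, which are then translated by rationals into the intervals \<open>(a, b)\<close>.\<close>

lemma dense_basis_exists:
  assumes K: "infinite K" and F: "|F| \<le>o |K|" and small: "|K :: real set| <o |UNIV :: real set|"
  obtains T where "indep F T" "\<And>b. \<exists>us. distinct us \<and> set us \<subseteq> T \<and> represents F us b"
    "\<And>x y. x < y \<Longrightarrow> \<exists>\<beta> :: real \<Rightarrow> real. bij_betw \<beta> (T \<inter> {x<..<y}) UNIV"
proof -
  obtain T0 where T0: "indep F T0" "\<And>T'. indep F T' \<Longrightarrow> T0 \<subseteq> T' \<Longrightarrow> T' = T0"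
    using maximal_indep_exists by metis
  have rep: "\<exists>us. distinct us \<and> set us \<subseteq> T0 \<and> represents F us b" for b
    using maximal_indep_represents[OF T0] by blast
  have big: "|UNIV :: real set| \<le>o |T0|"
  proof (rule ccontr)
    assume "\<not> |UNIV :: real set| \<le>o |T0|"
    then have "|T0| <o |UNIV :: real set|" by (simp add: not_ordLeq_iff_ordLess card_of_Well_order)
    then have less: "|K \<union> T0| <o |UNIV :: real set|"
      using small by (intro card_of_Un_ordLess_infinite) (auto simp: infinite_UNIV_char_0)
    have "|K| \<le>o |K \<union> T0|" "|T0| \<le>o |K \<union> T0|" by (auto intro: card_of_mono1)
    then have "|UNIV :: real set| \<le>o |K \<union> T0|"
      using K F rep by (intro card_of_represented[of _ F T0]) (auto intro: ordLeq_transitive)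
    then show False using less not_ordLess_ordLeq by blast
  qed
  have inf: "infinite T0"
    using big infinite_UNIV_char_0[where 'a = real] card_of_ordLeq_infinite by blast
  have "|T0 \<times> (UNIV :: nat set)| =o |T0|"
    using inf by (intro card_of_Times_infinite_simps) (auto simp: infinite_iff_card_of_nat)
  then obtain \<theta> where \<theta>: "bij_betw \<theta> (T0 \<times> (UNIV :: nat set)) T0"
    unfolding card_of_ordIso[symmetric] by blast
  define p where "p t = snd (inv_into (T0 \<times> (UNIV :: nat set)) \<theta> t)" for t
  have fibre: "\<exists>\<phi>. inj_on \<phi> T0 \<and> \<phi> ` T0 \<subseteq> {t \<in> T0. p t = j}" for j
  proof (intro exI conjI)
    show "inj_on (\<lambda>t. \<theta> (t, j)) T0"
      using \<theta> by (auto simp: bij_betw_def inj_on_def)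
    show "(\<lambda>t. \<theta> (t, j)) ` T0 \<subseteq> {t \<in> T0. p t = j}"
      using \<theta> by (auto simp: p_def bij_betw_def)
  qed
  define q :: "real \<Rightarrow> rat" where
    "q t = (SOME q. case from_nat (p t) of (a, b) \<Rightarrow> a < b \<longrightarrow> of_rat a < t + of_rat q \<and> t + of_rat q < of_rat b)" for t
  have q: "of_rat a < t + of_rat (q t) \<and> t + of_rat (q t) < of_rat b" if "p t = to_nat (a, b)" "a < b" for t a b
  proof -
    have "of_rat a - t < of_rat b - t" using that by (simp add: of_rat_less)
    then obtain r where "of_rat a - t < of_rat r" "of_rat r < of_rat b - t" using of_rat_dense by blast
    then have "\<exists>q. case from_nat (p t) of (a, b) \<Rightarrow> a < b \<longrightarrow> of_rat a < t + of_rat q \<and> t + of_rat q < of_rat b"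
      using that by (intro exI[of _ r]) (simp add: algebra_simps)
    from someI_ex[OF this] show ?thesis using that unfolding q_def[symmetric] by simp
  qed
  define \<tau> where "\<tau> t = t + of_rat (q t)" for t
  have inj: "inj_on \<tau> T0" unfolding \<tau>_def by (rule indep_translate_inj[OF T0(1)])
  show thesis
  proof (rule that[of "\<tau> ` T0"])
    show "indep F (\<tau> ` T0)" unfolding \<tau>_def by (rule indep_translate[OF T0(1)])
    show "\<exists>us. distinct us \<and> set us \<subseteq> \<tau> ` T0 \<and> represents F us b" for b
    proof -
      obtain us where us: "distinct us" "set us \<subseteq> T0" "represents F us b" using rep by blast
      have "distinct (map \<tau> us)" using us inj by (auto simp: distinct_map intro: inj_on_subset)
      moreover have "represents F (map \<tau> us) b" 
        using represents_translate[OF us(3), of q] by (simp add: \<tau>_def[abs_def])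
      ultimately show ?thesis using us(2) by (intro exI[of _ "map \<tau> us"]) auto
    qed
    fix x y :: real assume "x < y"
    obtain a where a: "x < of_rat a" "of_rat a < y" using of_rat_dense[OF \<open>x < y\<close>] by blast
    obtain b where b: "of_rat a < (of_rat b :: real)" "of_rat b < y" using of_rat_dense[OF a(2)] by blast
    have ab: "a < b" using b by (simp add: of_rat_less)
    obtain \<phi> where \<phi>: "inj_on \<phi> T0" "\<phi> ` T0 \<subseteq> {t \<in> T0. p t = to_nat (a, b)}" using fibre by blast
    have "inj_on (\<tau> \<circ> \<phi>) T0"
      by (rule comp_inj_on[OF \<phi>(1) inj_on_subset[OF inj]]) (use \<phi>(2) in auto)
    moreover have "(\<tau> \<circ> \<phi>) ` T0 \<subseteq> \<tau> ` T0 \<inter> {x<..<y}"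
    proof
      fix s assume "s \<in> (\<tau> \<circ> \<phi>) ` T0"
      then obtain t where t: "t \<in> T0" "p t = to_nat (a, b)" "s = \<tau> t" using \<phi>(2) by auto
      then show "s \<in> \<tau> ` T0 \<inter> {x<..<y}" using q[OF t(2) ab] a b by (auto simp: \<tau>_def)
    qed
    ultimately have "|T0| \<le>o |\<tau> ` T0 \<inter> {x<..<y}|"
      using card_of_ordLeq by blast
    then have "|UNIV :: real set| \<le>o |\<tau> ` T0 \<inter> {x<..<y}|"
      using big ordLeq_transitive by blast
    moreover have "|\<tau> ` T0 \<inter> {x<..<y}| \<le>o |UNIV :: real set|"
      by (rule card_of_mono1) simp
    ultimately have "|\<tau> ` T0 \<inter> {x<..<y}| =o |UNIV :: real set|"
      by (simp add: ordIso_iff_ordLeq)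
    then show "\<exists>\<beta> :: real \<Rightarrow> real. bij_betw \<beta> (\<tau> ` T0 \<inter> {x<..<y}) UNIV"
      unfolding card_of_ordIso[symmetric] .
  qed
qed

section \<open>The pieces\<close>

definition pts :: "real set \<Rightarrow> real list \<Rightarrow> real \<Rightarrow> real list set" where
  "pts T cs e = {us. length us = length cs \<and> set us \<subseteq> T \<and> (\<forall>i<length cs. \<bar>us ! i - cs ! i\<bar> < e)}"

definition ev :: "((nat \<Rightarrow> complex) \<Rightarrow> complex) list \<Rightarrow> real list \<Rightarrow> real list" where
  "ev ps us = map (\<lambda>\<phi>. Re (\<phi> (emb us))) ps"

definition separated :: "real list \<Rightarrow> real \<Rightarrow> bool" where
  "separated cs e \<longleftrightarrow> 0 < e \<and> (\<forall>i<length cs. \<forall>j<length cs. i \<noteq> j \<longrightarrow> 2 * e \<le> \<bar>cs ! i - cs ! j\<bar>)"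

definition chart ::
    "real set \<Rightarrow> real set \<Rightarrow> ((nat \<Rightarrow> complex) \<Rightarrow> complex) list \<Rightarrow> real list \<Rightarrow> real \<Rightarrow> bool" where
  "chart F T ps cs e \<longleftrightarrow> separated cs e \<and> set ps \<subseteq> Cl F \<and>
     (\<forall>\<phi>\<in>set ps. hol (polydisc cs e) \<phi> \<and> (\<forall>us\<in>pts T cs e. \<phi> (emb us) \<in> \<real>)) \<and>
     inj_on (ev ps) (pts T cs e)"

definition block :: "nat \<Rightarrow> nat \<Rightarrow> (rat \<times> nat) list" where
  "block d r = map (\<lambda>i. (0, r * d + i)) [0..<d]"

lemma length_block [simp]: "length (block d r) = d"
  by (simp add: block_def)

lemma length_concat_blocks: "(\<And>us. us \<in> set uss \<Longrightarrow> length us = d) \<Longrightarrow> length (concat uss) = length uss * d"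
  by (induction uss) auto

lemma nth_concat_blocks:
  assumes "\<And>us. us \<in> set uss \<Longrightarrow> length us = d" "r < length uss" "i < d"
  shows "concat uss ! (r * d + i) = uss ! r ! i"
  using assms
proof (induction uss arbitrary: r)
  case (Cons u uss)
  then show ?case by (cases r) (auto simp: nth_append)
qed simp

lemma act_block:
  assumes "\<And>us. us \<in> set uss \<Longrightarrow> length us = d" "r < length uss"
  shows "act (block d r) (concat uss) = uss ! r"
  using assms index_less[of r "length uss" _ d]
  by (intro nth_equalityI) (auto simp: act_def block_def nth_concat_blocks length_concat_blocks)

lemma emb_in_polydisc_pts: "us \<in> pts T cs e \<Longrightarrow> emb us \<in> polydisc cs e"
  by (simp add: pts_def emb_in_polydisc)

lemma separated_nth_eq:
  assumes "separated cs e" "us \<in> pts T cs e" "vs \<in> pts T cs e" "i < length cs" "j < length cs" "us ! i = vs ! j"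
  shows "i = j"
proof (rule ccontr)
  assume "i \<noteq> j"
  then have "2 * e \<le> \<bar>cs ! i - cs ! j\<bar>" using assms by (simp add: separated_def)
  moreover have "\<bar>us ! i - cs ! i\<bar> < e" "\<bar>vs ! j - cs ! j\<bar> < e" using assms by (auto simp: pts_def)
  ultimately show False using assms(6) by linarith
qed

lemma indep_transfer_blocks:
  assumes T: "indep F T" and f: "f \<in> Cl F" and hol: "hol (polydisc (concat (replicate (length uss) cs)) e) f"
    and sep: "separated cs e" and uss: "set uss \<subseteq> pts T cs e" and z: "f (emb (concat uss)) = 0"
    and len: "length vss = length uss" and vss: "set vss \<subseteq> pts UNIV cs e"
    and eq: "\<And>r s i. r < length uss \<Longrightarrow> s < length uss \<Longrightarrow> i < length cs \<Longrightarrow> uss ! r ! i = uss ! s ! i \<Longrightarrow>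
        vss ! r ! i = vss ! s ! i"
  shows "f (emb (concat vss)) = 0"
proof -
  define d where "d = length cs"
  define k where "k = length uss"
  have lu: "length us = d" if "us \<in> set uss" for us using that uss by (auto simp: pts_def d_def)
  have lv: "length us = d" if "us \<in> set vss" for us using that vss by (auto simp: pts_def d_def)
  have lc: "length us = d" if "us \<in> set (replicate k cs)" for us using that by (simp add: d_def)
  have lens: "length (concat uss) = k * d" "length (concat vss) = k * d" "length (concat (replicate k cs)) = k * d"
    using length_concat_blocks[of uss d, OF lu] length_concat_blocks[of vss d, OF lv]
      length_concat_blocks[of "replicate k cs" d, OF lc] len
    by (simp_all add: k_def)
  have idx: "\<exists>r i. p = r * d + i \<and> r < k \<and> i < d" if "p < k * d" for p
  proof -
    have "0 < d" using that by (cases d) auto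
    then show ?thesis
      using that by (intro exI[of _ "p div d"] exI[of _ "p mod d"]) (auto simp: less_mult_imp_div_less)
  qed
  have nth: "concat uss ! (r * d + i) = uss ! r ! i" "concat vss ! (r * d + i) = vss ! r ! i"
      "concat (replicate k cs) ! (r * d + i) = cs ! i" if "r < k" "i < d" for r i
    using that len nth_concat_blocks[of uss d r i] nth_concat_blocks[of vss d r i]
      nth_concat_blocks[of "replicate k cs" d r i] lu lv lc by (auto simp: k_def)
  have us_r: "uss ! r \<in> pts T cs e" "vss ! r \<in> pts UNIV cs e" if "r < k" for r
    using that uss vss len by (auto simp: k_def)
  have disc: "emb (concat wss) \<in> polydisc (concat (replicate k cs)) e"
    if "length wss = k" "set wss \<subseteq> pts UNIV cs e" for wss
  proof -
    have lw: "length us = d" if "us \<in> set wss" for us using that \<open>set wss \<subseteq> _\<close> by (auto simp: pts_def d_def)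
    have "length (concat wss) = k * d" using length_concat_blocks[of wss d, OF lw] that by simp
    then show ?thesis
      unfolding emb_in_polydisc[OF trans[OF \<open>length (concat wss) = k * d\<close> lens(3)[symmetric]]] lens(3)
    proof (intro allI impI)
      fix p assume "p < k * d"
      then obtain r i where p: "p = r * d + i" "r < k" "i < d" using idx by blast
      have "concat wss ! p = wss ! r ! i" "concat (replicate k cs) ! p = cs ! i"
        using p that by (simp_all add: nth_concat_blocks[of wss d, OF lw] nth(3))
      moreover have "wss ! r \<in> pts UNIV cs e" using that p by auto
      ultimately show "\<bar>concat wss ! p - concat (replicate k cs) ! p\<bar> < e"
        using p by (simp add: pts_def d_def)
    qed
  qed
  have ptsU: "pts T cs e \<subseteq> pts UNIV cs e" by (auto simp: pts_def)
  have e: "0 < e" using sep by (simp add: separated_def)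
  show ?thesis
  proof (rule indep_transfer[OF T f])
    show "set (concat uss) \<subseteq> T" using uss by (auto simp: pts_def)
    show "length (concat (replicate k cs)) = length (concat uss)" by (simp only: lens)
    show "hol (polydisc (concat (replicate k cs)) e) f" using hol by (simp only: k_def)
    show "emb (concat uss) \<in> polydisc (concat (replicate k cs)) e"
      using disc[of uss] uss ptsU by (auto simp: k_def)
    show "emb (concat vss) \<in> polydisc (concat (replicate k cs)) e"
      using disc[of vss] vss len by (auto simp: k_def)
    fix p q assume pq: "p < length (concat uss)" "q < length (concat uss)" "concat uss ! p = concat uss ! q"
    obtain r i where p: "p = r * d + i" "r < k" "i < d" using idx pq lens by metis
    obtain s j where q: "q = s * d + j" "s < k" "j < d" using idx pq lens by metis
    have e': "uss ! r ! i = uss ! s ! j" using pq(3) p q nth(1) by (simp add: k_def)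
    then have ij: "i = j" using separated_nth_eq[OF sep us_r(1) us_r(1)] p q by (simp add: d_def)
    show "concat (replicate k cs) ! p = concat (replicate k cs) ! q"
      using p q ij nth(3) by simp
    have "vss ! r ! i = vss ! s ! j"
      unfolding ij[symmetric] by (rule eq) (use e' ij p q in \<open>simp_all add: d_def k_def\<close>)
    then show "emb (concat vss) p = emb (concat vss) q"
      using pq p q nth(2) len lens by (simp add: emb_def k_def)
  qed (fact z e)+
qed

lemma common_support:
  assumes rep: "\<And>b. \<exists>us. distinct us \<and> set us \<subseteq> T \<and> represents F us b"
  shows "\<exists>us. distinct us \<and> set us \<subseteq> T \<and> (\<forall>b\<in>set a. represents F us b)"
proof (induction a)
  case (Cons b a)
  then obtain us where us: "distinct us" "set us \<subseteq> T" "\<And>c. c \<in> set a \<Longrightarrow> represents F us c" by blast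
  obtain vs where vs: "set vs \<subseteq> T" "represents F vs b" using rep by blast
  have "represents F (remdups (us @ vs)) c" if "c \<in> set (b # a)" for c
    using that us(3) vs(2) represents_weaken[of F us c "remdups (us @ vs)"]
      represents_weaken[of F vs b "remdups (us @ vs)"] by auto
  then show ?case
    using us vs by (intro exI[of _ "remdups (us @ vs)"]) simp
qed (auto intro: exI[of _ "[]"])

lemma represents_list:
  assumes "\<forall>b\<in>set a. represents F us b"
  shows "\<exists>ps. \<exists>e>0. length ps = length a \<and> set ps \<subseteq> Cl F \<and> (\<forall>\<phi>\<in>set ps. hol (polydisc us e) \<phi>) \<and>
    map (\<lambda>\<phi>. \<phi> (emb us)) ps = map of_real a"
  using assms
proof (induction a)
  case (Cons b a)
  then obtain ps e where ps: "0 < e" "length ps = length a" "set ps \<subseteq> Cl F" "\<forall>\<phi>\<in>set ps. hol (polydisc us e) \<phi>"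
    "map (\<lambda>\<phi>. \<phi> (emb us)) ps = map of_real a" by (meson list.set_intros(2))
  obtain \<phi> e' where \<phi>: "\<phi> \<in> Cl F" "0 < e'" "hol (polydisc us e') \<phi>" "\<phi> (emb us) = of_real b"
    using Cons.prems unfolding represents_def by auto
  have "hol (polydisc us (min e e')) \<psi>" if "\<psi> \<in> set (\<phi> # ps)" for \<psi>
    using that ps(4) hol_subset[OF \<phi>(3) polydisc_mono[of "min e e'"]]
      hol_subset[of "polydisc us e" \<psi>, OF _ polydisc_mono[of "min e e'"]] by auto
  then show ?case
    using ps \<phi> by (intro exI[of _ "\<phi> # ps"] exI[of _ "min e e'"]) auto
qed (auto intro: exI[of _ 1])

lemma rational_separated_discs:
  assumes us: "distinct us" and e0: "0 < (e0 :: real)"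
  obtains rs r where "length rs = length us" "separated (map of_rat rs) (of_rat r)"
    "\<And>i. i < length us \<Longrightarrow> \<bar>us ! i - of_rat (rs ! i)\<bar> < of_rat r"
    "polydisc (map of_rat rs) (of_rat r) \<subseteq> polydisc us e0"
proof -
  define D where "D = insert e0 ((\<lambda>(i, j). \<bar>us ! i - us ! j\<bar>) ` {(i, j). i < length us \<and> j < length us \<and> i \<noteq> j})"
  have "finite {(i, j). i < length us \<and> j < length us \<and> i \<noteq> j}"
    by (rule finite_subset[of _ "{..<length us} \<times> {..<length us}"]) auto
  then have finD: "finite D" unfolding D_def by blast
  define \<delta> where "\<delta> = Min D"
  have "\<forall>x\<in>D. 0 < x" using us e0 by (auto simp: D_def nth_eq_iff_index_eq)
  then have \<delta>: "0 < \<delta>" using finD by (auto simp: \<delta>_def D_def)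
  have \<delta>e: "\<delta> \<le> e0" using finD unfolding \<delta>_def by (intro Min_le) (auto simp: D_def)
  have \<delta>u: "\<delta> \<le> \<bar>us ! i - us ! j\<bar>" if "i < length us" "j < length us" "i \<noteq> j" for i j
  proof -
    have "\<bar>us ! i - us ! j\<bar> \<in> D" unfolding D_def using that by (intro insertI2 image_eqI[of _ _ "(i, j)"]) simp_all
    then show ?thesis using finD unfolding \<delta>_def by (intro Min_le)
  qed
  have "0 < \<delta> / 4" using \<delta> by simp
  from of_rat_dense[OF this] obtain r where r: "0 < (of_rat r :: real)" "of_rat r < \<delta> / 4" by blast
  have "\<exists>s. us ! i < of_rat s \<and> of_rat s < us ! i + of_rat r" for i
    using of_rat_dense[of "us ! i" "us ! i + of_rat r"] r(1) by simp
  then obtain s where s: "\<And>i. us ! i < of_rat (s i)" "\<And>i. of_rat (s i) < us ! i + of_rat r" by metis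
  define rs where "rs = map s [0..<length us]"
  have close: "\<bar>us ! i - of_rat (rs ! i)\<bar> < of_rat r" if "i < length us" for i
    using s[of i] that by (simp add: rs_def)
  show thesis
  proof (rule that[of rs r])
    show "separated (map of_rat rs) (of_rat r)"
      unfolding separated_def
    proof (intro conjI allI impI)
      fix i j assume ij: "i < length (map real_of_rat rs)" "j < length (map real_of_rat rs)" "i \<noteq> j"
      then have "\<delta> \<le> \<bar>us ! i - us ! j\<bar>" "\<bar>us ! i - of_rat (rs ! i)\<bar> < of_rat r" "\<bar>us ! j - of_rat (rs ! j)\<bar> < of_rat r"
        using \<delta>u close by (auto simp: rs_def)
      then have "2 * of_rat r \<le> \<bar>of_rat (rs ! i) - (of_rat (rs ! j) :: real)\<bar>" using r by linarith
      then show "2 * of_rat r \<le> \<bar>map of_rat rs ! i - (map of_rat rs ! j :: real)\<bar>" using ij by simp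
    qed (use r in simp)
    show "polydisc (map of_rat rs) (of_rat r) \<subseteq> polydisc us e0"
    proof
      fix x assume x: "x \<in> polydisc (map of_rat rs) (of_rat r)"
      have "dist (x i) (of_real (us ! i)) < e0" if i: "i < length us" for i
      proof -
        have "dist (x i) (of_real (us ! i)) \<le> dist (x i) (of_real (of_rat (rs ! i))) + dist (complex_of_real (us ! i)) (of_real (of_rat (rs ! i)))"
          by (rule dist_triangle2)
        moreover have "dist (complex_of_real (us ! i)) (of_real (of_rat (rs ! i))) = \<bar>us ! i - of_rat (rs ! i)\<bar>"
          by (metis dist_norm norm_of_real of_real_diff real_norm_def)
        moreover have "dist (x i) (of_real (of_rat (rs ! i))) < of_rat r" using x i by (simp add: polydisc_def rs_def)
        ultimately show ?thesis using close[OF i] r \<delta>e by linarith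
      qed
      then show "x \<in> polydisc us e0" using x by (simp add: polydisc_def rs_def)
    qed
  qed (use close in \<open>auto simp: rs_def\<close>)
qed

text \<open>The function \<open>f\<close> in the proof is the difference of \<open>\<phi>\<close> and its reflection in the real axis.\<close>

lemma indep_real_valued:
  assumes T: "indep F T" and \<phi>: "\<phi> \<in> Cl F" "hol (polydisc cs e) \<phi>" and us: "distinct us" "us \<in> pts T cs e"
    and e: "0 < e" and real: "\<phi> (emb us) \<in> \<real>" and vs: "vs \<in> pts T cs e"
  shows "\<phi> (emb vs) \<in> \<real>"
proof -
  define f where "f x = \<phi> x + of_rat (-1) * cnj (\<phi> (\<lambda>i. cnj (x i)))" for x
  have cnj_emb: "(\<lambda>i. cnj (emb ws i)) = emb ws" for ws by (auto simp: emb_def)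
  have val: "f (emb ws) = 0 \<longleftrightarrow> \<phi> (emb ws) \<in> \<real>" for ws
    by (simp add: f_def cnj_emb of_rat_minus complex_is_Real_iff complex_eq_iff)
  have C: "f \<in> Cl F" unfolding f_def
    by (rule Cl_add[OF \<phi>(1) Cl_mult[OF Cl_rat Cl_cnj[OF \<phi>(1)]]])
  have "(\<lambda>i. cnj (x i)) \<in> polydisc cs e" if "x \<in> polydisc cs e" for x
  proof -
    have "dist (cnj z) (of_real c) = dist z (of_real c)" for z c
      using complex_mod_cnj[of "z - of_real c"] by (simp add: dist_norm)
    then show ?thesis using that by (simp add: polydisc_def)
  qed
  then have h: "hol (polydisc cs e) f" unfolding f_def
    by (intro hol_add hol_mult hol_const \<phi>(2) hol_cnj[OF \<phi>(2)])
  have "set us \<subseteq> T" "length cs = length us" using us by (simp_all add: pts_def)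
  from indepD[OF T C us(1) this e h emb_in_polydisc_pts[OF us(2)] _ emb_in_polydisc_pts[OF vs]]
  have "f (emb vs) = 0" using real by (simp add: val)
  then show ?thesis by (simp add: val)
qed

lemma hol_block:
  assumes "hol (polydisc cs e) \<phi>" "0 < e" "r < k"
  shows "hol (polydisc (concat (replicate k cs)) e) (\<lambda>x. \<phi> (sub (block (length cs) r) x))"
proof (rule hol_sub_polydisc[OF _ assms(2)])
  have "act (block (length cs) r) (concat (replicate k cs)) = cs"
    using assms(3) by (subst act_block) auto
  then show "hol (polydisc (act (block (length cs) r) (concat (replicate k cs))) e) \<phi>"
    using assms(1) by simp
qed

lemma sub_block_emb:
  assumes "set uss \<subseteq> pts T cs e" "r < length uss"
  shows "sub (block (length cs) r) (emb (concat uss)) = emb (uss ! r)"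
proof -
  have "length us = length cs" if "us \<in> set uss" for us using that assms by (auto simp: pts_def)
  then show ?thesis using assms(2) by (simp add: sub_emb act_block)
qed

lemma represents_drop_coordinate:
  assumes f: "f \<in> Cl F" "hol (polydisc cs e) f" and e: "0 < e" and us: "length us = length cs"
    and c: "c < length cs" and disc: "emb (us[c := of_rat q]) \<in> polydisc cs e"
    and val: "f (emb (us[c := of_rat q])) = of_real b"
  shows "represents F (take c us @ drop (Suc c) us) b"
proof -
  let ?us' = "us[c := of_rat q]" and ?vs = "take c us @ drop (Suc c) us"
  define l where "l = map (\<lambda>i. if i < c then (0 :: rat, i) else if i = c then (q, length us) else (0, i - 1)) [0..<length us]"
  have act: "act l ?vs = ?us'"
  proof (rule nth_equalityI)
    fix i assume "i < length (act l ?vs)"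
    then have i: "i < length us" by (simp add: l_def)
    consider "i < c" | "i = c" | "c < i" by linarith
    then show "act l ?vs ! i = ?us' ! i"
    proof cases
      case 3
      then have "i - 1 - c + Suc c = i" "\<not> i - Suc 0 < c" "i - Suc 0 < length cs - Suc 0"
        using i us by linarith+
      then show ?thesis using 3 i c us by (simp add: act_def l_def nth_append)
    qed (use i c us in \<open>simp_all add: act_def l_def nth_append\<close>)
  qed (simp add: l_def)
  obtain e' where e': "0 < e'" "polydisc ?us' e' \<subseteq> polydisc cs e"
    by (rule polydisc_recenter[OF disc _ e]) (use us in simp_all)
  show ?thesis
    unfolding represents_def
  proof (intro bexI[OF _ Cl_sub[OF f(1), of l]] exI conjI)
    show "hol (polydisc ?vs e') (\<lambda>x. f (sub l x))"
      using e' hol_subset[OF f(2) e'(2)] by (intro hol_sub_polydisc) (simp_all add: act)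
    show "f (sub l (emb ?vs)) = of_real b" using val by (simp add: sub_emb act)
  qed (rule e')
qed

text \<open>Two points of the parameter set with the same image would let one coordinate of the minimal
  support be replaced by a rational constant.\<close>

lemma ev_inj_on_minimal_support:
  assumes T: "indep F T" and cs: "cs = map of_rat rs" and sep: "separated cs e"
    and ps: "set ps \<subseteq> Cl F" "\<And>\<phi>. \<phi> \<in> set ps \<Longrightarrow> hol (polydisc cs e) \<phi>"
    and real: "\<And>\<phi> ws. \<phi> \<in> set ps \<Longrightarrow> ws \<in> pts T cs e \<Longrightarrow> \<phi> (emb ws) \<in> \<real>"
    and us: "distinct us" "us \<in> pts T cs e" and val: "map (\<lambda>\<phi>. \<phi> (emb us)) ps = map of_real a"
    and min: "\<And>vs. distinct vs \<Longrightarrow> set vs \<subseteq> T \<Longrightarrow> \<forall>b\<in>set a. represents F vs b \<Longrightarrow> length us \<le> length vs"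
  shows "inj_on (ev ps) (pts T cs e)"
proof (rule inj_onI, rule ccontr)
  fix v w assume v: "v \<in> pts T cs e" and w: "w \<in> pts T cs e" and eq: "ev ps v = ev ps w" and "v \<noteq> w"
  have e: "0 < e" using sep by (simp add: separated_def)
  have len: "length v = length cs" "length w = length cs" "length us = length cs"
    using v w us(2) by (simp_all add: pts_def)
  then obtain c where c: "c < length cs" "v ! c \<noteq> w ! c" using \<open>v \<noteq> w\<close> by (metis nth_equalityI)
  let ?us' = "us[c := cs ! c]"
  have us': "?us' \<in> pts UNIV cs e"
    using us(2) e c(1) by (auto simp: pts_def nth_list_update)
  have usU: "us \<in> pts UNIV cs e" using us(2) by (auto simp: pts_def)
  have us'_val: "\<phi> (emb ?us') = \<phi> (emb us)" if \<phi>: "\<phi> \<in> set ps" for \<phi>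
  proof -
    define f where "f x = \<phi> (sub (block (length cs) 0) x) + of_rat (-1) * \<phi> (sub (block (length cs) 1) x)" for x
    have \<phi>C: "\<phi> \<in> Cl F" using \<phi> ps(1) by auto
    have fC: "f \<in> Cl F" unfolding f_def
      by (rule Cl_add[OF Cl_sub[OF \<phi>C] Cl_mult[OF Cl_rat Cl_sub[OF \<phi>C]]])
    have val2: "f (emb (concat [x, y])) = \<phi> (emb x) - \<phi> (emb y)" if "x \<in> pts UNIV cs e" "y \<in> pts UNIV cs e" for x y
    proof -
      have s: "set [x, y] \<subseteq> pts UNIV cs e" using that by simp
      show ?thesis
        unfolding f_def sub_block_emb[OF s, of 0, simplified] sub_block_emb[OF s, of 1, simplified]
        using sub_block_emb[OF s, of 0] sub_block_emb[OF s, of 1] by (simp add: of_rat_minus)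
    qed
    have "f (emb (concat [us, ?us'])) = 0"
    proof (rule indep_transfer_blocks[OF T fC _ sep, of "[v, w]"])
      have "hol (polydisc (concat (replicate 2 cs)) e) f"
        unfolding f_def by (intro hol_add hol_mult hol_const hol_block ps(2) \<phi> e) auto
      then show "hol (polydisc (concat (replicate (length [v, w]) cs)) e) f" by (simp add: numeral_2_eq_2)
      have "Re (\<phi> (emb v)) = Re (\<phi> (emb w))" using eq \<phi> by (auto simp: ev_def)
      then have "\<phi> (emb v) = \<phi> (emb w)"
        using real[OF \<phi> v] real[OF \<phi> w] by (metis of_real_Re)
      then show "f (emb (concat [v, w])) = 0"
        using v w by (subst val2) (auto simp: pts_def)
      fix r s i assume "r < length [v, w]" "s < length [v, w]" "i < length cs" "[v, w] ! r ! i = [v, w] ! s ! i"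
      then show "[us, ?us'] ! r ! i = [us, ?us'] ! s ! i"
        using c len by (cases "i = c") (auto simp: less_Suc_eq nth_list_update)
    qed (use v w us' usU in auto)
    then show ?thesis using val2[OF usU us'] by simp
  qed
  let ?vs = "take c us @ drop (Suc c) us"
  have "represents F ?vs b" if b: "b \<in> set a" for b
  proof -
    obtain \<phi> where \<phi>: "\<phi> \<in> set ps" "\<phi> (emb us) = of_real b"
    proof -
      have "complex_of_real b \<in> set (map of_real a)" using b by simp
      then have "complex_of_real b \<in> set (map (\<lambda>\<phi>. \<phi> (emb us)) ps)" by (simp only: val)
      then show thesis using that by auto
    qed
    have cc: "cs ! c = of_rat (rs ! c)" using c by (simp add: cs)
    show ?thesis
    proof (rule represents_drop_coordinate[of \<phi> F cs e us c "rs ! c"])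
      show "emb (us[c := of_rat (rs ! c)]) \<in> polydisc cs e"
        using emb_in_polydisc_pts[OF us'] by (simp only: cc)
      show "\<phi> (emb (us[c := of_rat (rs ! c)])) = of_real b"
        using us'_val[OF \<phi>(1)] \<phi>(2) by (simp only: cc)
    qed (use \<phi> ps e len c in auto)
  qed
  moreover have "set ?vs \<subseteq> T" using us(2) by (auto simp: pts_def dest: in_set_takeD in_set_dropD)
  moreover have "distinct ?vs" using us(1) by (simp add: set_take_disj_set_drop_if_distinct)
  ultimately have "length us \<le> length ?vs" using min by blast
  then show False using c len by simp
qed

lemma chart_exists:
  assumes T: "indep F T" and rep: "\<And>b. \<exists>us. distinct us \<and> set us \<subseteq> T \<and> represents F us b"
  shows "\<exists>ps rs r. length ps = length a \<and> chart F T ps (map of_rat rs) (of_rat r) \<and>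
    a \<in> ev ps ` pts T (map of_rat rs) (of_rat r)"
proof -
  let ?J = "\<lambda>us. distinct us \<and> set us \<subseteq> T \<and> (\<forall>b\<in>set a. represents F us b)"
  obtain us0 where "?J us0" using common_support[OF rep] by blast
  from ex_has_least_nat[of ?J, OF this, of length]
  obtain us where us: "?J us" and min: "\<And>vs. ?J vs \<Longrightarrow> length us \<le> length vs" by blast
  obtain ps e0 where ps: "0 < e0" "length ps = length a" "set ps \<subseteq> Cl F" "\<forall>\<phi>\<in>set ps. hol (polydisc us e0) \<phi>"
    "map (\<lambda>\<phi>. \<phi> (emb us)) ps = map of_real a"
    using represents_list[of a F us] us by blast
  obtain rs r where rs: "length rs = length us" "separated (map of_rat rs) (of_rat r)"
    "\<And>i. i < length us \<Longrightarrow> \<bar>us ! i - of_rat (rs ! i)\<bar> < of_rat r"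
    "polydisc (map of_rat rs) (of_rat r) \<subseteq> polydisc us e0"
    using rational_separated_discs[OF _ ps(1), of us] us by blast
  let ?cs = "map of_rat rs" and ?e = "of_rat r"
  have e: "0 < (?e :: real)" using rs(2) by (simp add: separated_def)
  have hol: "hol (polydisc ?cs ?e) \<phi>" if "\<phi> \<in> set ps" for \<phi>
    using that ps(4) by (intro hol_subset[OF _ rs(4)]) auto
  have usp: "us \<in> pts T ?cs ?e" using us rs by (auto simp: pts_def)
  have val: "\<phi> (emb us) \<in> \<real>" if "\<phi> \<in> set ps" for \<phi>
  proof -
    have "\<phi> (emb us) \<in> set (map (\<lambda>\<phi>. \<phi> (emb us)) ps)" using that by simp
    then have "\<phi> (emb us) \<in> set (map complex_of_real a)" by (simp only: ps(5))
    then show ?thesis by auto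
  qed
  have real: "\<phi> (emb ws) \<in> \<real>" if "\<phi> \<in> set ps" "ws \<in> pts T ?cs ?e" for \<phi> ws
    by (rule indep_real_valued[OF T _ hol[OF that(1)] _ usp e val[OF that(1)] that(2)]) (use that ps(3) us in auto)
  have "inj_on (ev ps) (pts T ?cs ?e)"
  proof (rule ev_inj_on_minimal_support[where a = a and us = us, OF T refl rs(2) ps(3)])
    show "length us \<le> length vs" if "distinct vs" "set vs \<subseteq> T" "\<forall>b\<in>set a. represents F vs b" for vs
      using that min by blast
  qed (use us usp ps(5) hol real in blast)+
  moreover have "a = ev ps us"
  proof -
    have "map Re (map (\<lambda>\<phi>. \<phi> (emb us)) ps) = a" by (simp only: ps(5)) (simp add: o_def)
    then show ?thesis by (simp add: ev_def o_def)
  qed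
  ultimately show ?thesis
    using ps(2,3) rs(2) hol real usp unfolding chart_def by (intro exI[of _ ps] exI[of _ rs] exI[of _ r]) blast
qed

definition alg_edges :: "nat \<Rightarrow> nat \<Rightarrow> ((nat \<Rightarrow> real) \<Rightarrow> real) \<Rightarrow> real list set set" where
  "alg_edges n k p = {e \<in> nsets (Rn n) k. \<exists>a. bij_betw a {..<k} e \<and> p (\<lambda>v. a (v div n) ! (v mod n)) = 0}"

lemma poly_over_cong: "poly_over F N p \<Longrightarrow> (\<And>v. v < N \<Longrightarrow> x v = y v) \<Longrightarrow> p x = p y"
  by (induction rule: poly_over.induct) auto

lemma ev_polynomial_transfer:
  assumes T: "indep F T" and ch: "chart F T ps cs e" and n: "length ps = n"
    and p: "poly_over F (k * n) p"
    and us: "\<And>r. r < k \<Longrightarrow> us r \<in> pts T cs e" and vs: "\<And>r. r < k \<Longrightarrow> vs r \<in> pts T cs e"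
    and eq: "\<And>r s i. r < k \<Longrightarrow> s < k \<Longrightarrow> i < length cs \<Longrightarrow> us r ! i = us s ! i \<Longrightarrow> vs r ! i = vs s ! i"
    and z: "p (\<lambda>v. ev ps (us (v div n)) ! (v mod n)) = 0"
  shows "p (\<lambda>v. ev ps (vs (v div n)) ! (v mod n)) = 0"
proof -
  obtain P where P: "complexifies F (k * n) p P"
    using poly_over_complexifies[OF p] by blast
  have sep: "separated cs e" and e: "0 < e" using ch by (simp_all add: chart_def separated_def)
  define \<psi> where "\<psi> v = (\<lambda>x. (ps ! (v mod n)) (sub (block (length cs) (v div n)) x))" for v
  define f where "f x = P (\<lambda>v. \<psi> v x)" for x
  have v: "ps ! (v mod n) \<in> set ps" "v div n < k" if "v < k * n" for v
  proof -
    have "0 < n" using that by (cases n) auto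
    then show "ps ! (v mod n) \<in> set ps" "v div n < k" using that n by (auto simp: less_mult_imp_div_less)
  qed
  have "\<psi> v \<in> Cl F" if "v < k * n" for v
    using v[OF that] ch unfolding \<psi>_def chart_def by (intro Cl_sub) blast
  then have fC: "f \<in> Cl F" using P unfolding complexifies_def f_def by blast
  have "hol (polydisc (concat (replicate k cs)) e) (\<psi> v)" if "v < k * n" for v
    unfolding \<psi>_def using v[OF that] ch e by (intro hol_block) (auto simp: chart_def)
  then have hol: "hol (polydisc (concat (replicate k cs)) e) f" using P unfolding complexifies_def f_def by blast
  have val: "f (emb (concat (map ws [0..<k]))) = of_real (p (\<lambda>v. ev ps (ws (v div n)) ! (v mod n)))"
    if ws: "\<And>r. r < k \<Longrightarrow> ws r \<in> pts T cs e" for ws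
  proof -
    have "\<psi> v (emb (concat (map ws [0..<k]))) = of_real (ev ps (ws (v div n)) ! (v mod n))" if "v < k * n" for v
    proof -
      have "v mod n < n" using that by (cases n) auto
      have s: "set (map ws [0..<k]) \<subseteq> pts T cs e" using ws by auto
      have "(ps ! (v mod n)) (emb (ws (v div n))) \<in> \<real>"
        using v[OF that] ch ws unfolding chart_def by blast
      then show ?thesis
        using sub_block_emb[OF s, of "v div n"] v[OF that] \<open>v mod n < n\<close> n
        by (simp add: \<psi>_def ev_def)
    qed
    moreover have "P x = of_real (p y)" if "\<forall>v<k * n. x v = of_real (y v)" for x y
      using P that unfolding complexifies_def by (elim conjE) simp
    ultimately show ?thesis unfolding f_def by simp
  qed
  have "f (emb (concat (map vs [0..<k]))) = 0"
  proof (rule indep_transfer_blocks[OF T fC _ sep, of "map us [0..<k]"])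
    show "f (emb (concat (map us [0..<k]))) = 0" using val[OF us] z by simp
    show "hol (polydisc (concat (replicate (length (map us [0..<k])) cs)) e) f" using hol by simp
    show "set (map us [0..<k]) \<subseteq> pts T cs e" using us by auto
    show "set (map vs [0..<k]) \<subseteq> pts UNIV cs e" using vs by (auto simp: pts_def)
    fix r s i assume "r < length (map us [0..<k])" "s < length (map us [0..<k])" "i < length cs"
      "map us [0..<k] ! r ! i = map us [0..<k] ! s ! i"
    then show "map vs [0..<k] ! r ! i = map vs [0..<k] ! s ! i" using eq[of r s i] by simp
  qed simp
  then show ?thesis using val[OF vs] by simp
qed

lemma bij_betw_pts:
  assumes "\<And>i. i < length cs \<Longrightarrow> bij_betw (\<beta> i) (T \<inter> {cs ! i - e<..<cs ! i + e}) UNIV"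
  shows "bij_betw (\<lambda>us. map (\<lambda>i. \<beta> i (us ! i)) [0..<length cs]) (pts T cs e) (Rn (length cs))"
proof -
  let ?B = "\<lambda>i. T \<inter> {cs ! i - e<..<cs ! i + e}"
  have inB: "us ! i \<in> ?B i" if "us \<in> pts T cs e" "i < length cs" for us i
    using that by (force simp: pts_def abs_less_iff)
  have inv: "inv_into (?B i) (\<beta> i) y \<in> ?B i" "\<beta> i (inv_into (?B i) (\<beta> i) y) = y" if "i < length cs" for i y
    using inv_into_into[of y "\<beta> i" "?B i"] f_inv_into_f[of y "\<beta> i" "?B i"] assms[OF that]
    by (simp_all only: bij_betw_def UNIV_I)
  show ?thesis
  proof (rule bij_betw_byWitness[where f' = "\<lambda>ys. map (\<lambda>i. inv_into (?B i) (\<beta> i) (ys ! i)) [0..<length cs]"])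
    show "\<forall>us\<in>pts T cs e. map (\<lambda>i. inv_into (?B i) (\<beta> i) (map (\<lambda>i. \<beta> i (us ! i)) [0..<length cs] ! i)) [0..<length cs] = us"
    proof
      fix us assume us: "us \<in> pts T cs e"
      show "map (\<lambda>i. inv_into (?B i) (\<beta> i) (map (\<lambda>i. \<beta> i (us ! i)) [0..<length cs] ! i)) [0..<length cs] = us"
      proof (rule nth_equalityI)
        fix i assume "i < length (map (\<lambda>i. inv_into (?B i) (\<beta> i) (map (\<lambda>i. \<beta> i (us ! i)) [0..<length cs] ! i)) [0..<length cs])"
        then have i: "i < length cs" by simp
        then show "map (\<lambda>i. inv_into (?B i) (\<beta> i) (map (\<lambda>i. \<beta> i (us ! i)) [0..<length cs] ! i)) [0..<length cs] ! i = us ! i"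
          using bij_betw_inv_into_left[OF assms[OF i] inB[OF us i]] by simp
      qed (use us in \<open>simp add: pts_def\<close>)
    qed
    show "\<forall>ys\<in>Rn (length cs). map (\<lambda>i. \<beta> i (map (\<lambda>i. inv_into (?B i) (\<beta> i) (ys ! i)) [0..<length cs] ! i)) [0..<length cs] = ys"
      using inv(2) by (auto simp: Rn_def intro!: nth_equalityI)
    show "(\<lambda>us. map (\<lambda>i. \<beta> i (us ! i)) [0..<length cs]) ` pts T cs e \<subseteq> Rn (length cs)"
      by (auto simp: Rn_def)
    show "(\<lambda>ys. map (\<lambda>i. inv_into (?B i) (\<beta> i) (ys ! i)) [0..<length cs]) ` Rn (length cs) \<subseteq> pts T cs e"
    proof (rule image_subsetI)
      fix ys :: "real list"
      have "inv_into (?B i) (\<beta> i) (ys ! i) \<in> T \<and> \<bar>inv_into (?B i) (\<beta> i) (ys ! i) - cs ! i\<bar> < e" if "i < length cs" for i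
        using inv(1)[OF that, of "ys ! i"] by (simp add: abs_less_iff)
      then show "map (\<lambda>i. inv_into (?B i) (\<beta> i) (ys ! i)) [0..<length cs] \<in> pts T cs e"
        by (auto simp: pts_def)
    qed
  qed
qed

lemma chart_edges_hom_closed:
  assumes T: "indep F T" and ch: "chart F T ps cs e" and n: "length ps = n"
    and \<beta>: "\<And>i. i < length cs \<Longrightarrow> bij_betw (\<beta> i) (T \<inter> {cs ! i - e<..<cs ! i + e}) UNIV"
    and p: "poly_over F (k * n) p"
  defines "A \<equiv> ev ps ` pts T cs e"
  defines "\<gamma> \<equiv> \<lambda>us. map (\<lambda>i. \<beta> i (us ! i)) [0..<length cs]"
  defines "g \<equiv> \<gamma> \<circ> inv_into (pts T cs e) (ev ps)"
  defines "E' \<equiv> (\<lambda>e. g ` e) ` induced_edges k (alg_edges n k p) A"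
  assumes Q: "Q \<in> E'" and Q': "Q' \<in> nsets (Rn (length cs)) k" and hom: "hom_image (length cs) Q Q'"
  shows "Q' \<in> E'"
proof -
  let ?d = "length cs" and ?X = "pts T cs e"
  have \<gamma>: "bij_betw \<gamma> ?X (Rn ?d)" unfolding \<gamma>_def by (rule bij_betw_pts[OF \<beta>])
  have ev: "bij_betw (ev ps) ?X A" using ch by (simp add: A_def chart_def bij_betw_def)
  have gev: "g (ev ps us) = \<gamma> us" if "us \<in> ?X" for us
    using bij_betw_inv_into_left[OF ev that] by (simp add: g_def)
  obtain e0 where e0: "e0 \<in> alg_edges n k p" "e0 \<in> nsets A k" "Q = g ` e0"
    using Q by (auto simp: E'_def induced_edges_def)
  obtain a where a: "bij_betw a {..<k} e0" "p (\<lambda>v. a (v div n) ! (v mod n)) = 0"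
    using e0(1) by (auto simp: alg_edges_def)
  obtain h where h: "template_hom ?d h Q Q'" using hom unfolding hom_image_def by (rule exE)
  have aA: "a r \<in> A" if "r < k" for r using a(1) e0(2) that by (auto simp: bij_betw_def nsets_def)
  define us where "us r = inv_into ?X (ev ps) (a r)" for r
  have us: "us r \<in> ?X" "ev ps (us r) = a r" if "r < k" for r
    using aA[OF that] ev by (auto simp: us_def bij_betw_def inv_into_into f_inv_into_f)
  have ga: "g (a r) = \<gamma> (us r)" if "r < k" for r using gev us that by metis
  have gQ: "g (a r) \<in> Q" if "r < k" for r using a(1) e0(3) that by (auto simp: bij_betw_def)
  have hQ: "h (g (a r)) \<in> Q'" if "r < k" for r using template_homD(1)[OF h] gQ[OF that] by blast
  have hR: "h (g (a r)) \<in> Rn ?d" if "r < k" for r using hQ[OF that] Q' by (auto simp: nsets_def)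
  define vs where "vs r = inv_into ?X \<gamma> (h (g (a r)))" for r
  have vs: "vs r \<in> ?X" "\<gamma> (vs r) = h (g (a r))" if "r < k" for r
    using hR[OF that] \<gamma> by (auto simp: vs_def bij_betw_def inv_into_into f_inv_into_f)
  have \<gamma>_nth: "\<gamma> ws ! i = \<beta> i (ws ! i)" if "i < ?d" for ws i using that by (simp add: \<gamma>_def)
  have inB: "ws ! i \<in> T \<inter> {cs ! i - e<..<cs ! i + e}" if "ws \<in> ?X" "i < ?d" for ws i
    using that by (force simp: pts_def abs_less_iff)
  have eq: "vs r ! i = vs s ! i" if rs: "r < k" "s < k" and i: "i < ?d" and u: "us r ! i = us s ! i" for r s i
  proof -
    have "g (a r) ! i = g (a s) ! i" using rs i u by (simp add: ga \<gamma>_nth)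
    then have "h (g (a r)) ! i = h (g (a s)) ! i"
      by (rule template_homD(3)[OF h gQ[OF rs(1)] gQ[OF rs(2)] i])
    then have "\<beta> i (vs r ! i) = \<beta> i (vs s ! i)" using vs(2) rs i by (metis \<gamma>_nth)
    then show ?thesis
      using bij_betw_imp_inj_on[OF \<beta>[OF i]] inB[OF vs(1)[OF rs(1)] i] inB[OF vs(1)[OF rs(2)] i]
      by (metis inj_onD)
  qed
  define a' where "a' r = ev ps (vs r)" for r
  have z: "p (\<lambda>v. a' (v div n) ! (v mod n)) = 0"
  proof -
    have "p (\<lambda>v. ev ps (us (v div n)) ! (v mod n)) = p (\<lambda>v. a (v div n) ! (v mod n))"
      by (rule poly_over_cong[OF p]) (use us(2) in \<open>simp add: less_mult_imp_div_less\<close>)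
    then have "p (\<lambda>v. ev ps (us (v div n)) ! (v mod n)) = 0" using a(2) by simp
    from ev_polynomial_transfer[OF T ch n p us(1) vs(1) eq this] show ?thesis by (simp add: a'_def)
  qed
  have inj: "inj_on a' {..<k}"
  proof (rule inj_onI)
    fix r s assume rs: "r \<in> {..<k}" "s \<in> {..<k}" "a' r = a' s"
    then have "vs r = vs s" using vs(1) ev by (auto simp: a'_def bij_betw_def dest: inj_onD)
    then have "h (g (a r)) = h (g (a s))" using vs(2) rs by (metis lessThan_iff)
    then have "g (a r) = g (a s)" using template_homD(2)[OF h] gQ rs by (auto dest: inj_onD)
    then have "us r = us s" using ga us \<gamma> rs by (auto simp: bij_betw_def dest: inj_onD)
    then have "a r = a s" using us(2) rs by (metis lessThan_iff)
    then show "r = s" using a(1) rs by (auto simp: bij_betw_def dest: inj_onD)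
  qed
  let ?e = "a' ` {..<k}"
  have eA: "?e \<in> nsets A k"
    using vs(1) card_image[OF inj] by (auto simp: nsets_def A_def a'_def)
  moreover have "?e \<in> alg_edges n k p"
  proof -
    have "A \<subseteq> Rn n" using n by (auto simp: A_def ev_def Rn_def)
    then have "?e \<in> nsets (Rn n) k" using eA by (auto simp: nsets_def)
    then show ?thesis unfolding alg_edges_def using inj z by (auto simp: bij_betw_def)
  qed
  moreover have "g ` ?e = Q'"
  proof (rule card_subset_eq)
    show "finite Q'" using Q' by (simp add: nsets_def)
    have ga': "g (a' r) = h (g (a r))" if "r < k" for r using gev vs that by (simp add: a'_def)
    then show "g ` ?e \<subseteq> Q'" using hQ by auto
    have "inj_on (\<lambda>r. g (a' r)) {..<k}"
    proof (rule inj_onI)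
      fix r s assume rs: "r \<in> {..<k}" "s \<in> {..<k}" "g (a' r) = g (a' s)"
      then have "\<gamma> (vs r) = \<gamma> (vs s)" using gev vs(1) by (simp add: a'_def)
      then have "vs r = vs s" using \<gamma> vs(1) rs by (auto simp: bij_betw_def dest: inj_onD)
      then have "a' r = a' s" by (simp add: a'_def)
      then show "r = s" using inj rs by (auto dest: inj_onD)
    qed
    then have "card ((\<lambda>r. g (a' r)) ` {..<k}) = k" by (simp add: card_image)
    then show "card (g ` ?e) = card Q'" using Q' by (simp add: image_image nsets_def)
  qed
  ultimately show ?thesis unfolding E'_def induced_edges_def by blast
qed

lemma algebraic_hg_iff: "algebraic_hg n k E \<longleftrightarrow> (\<exists>p. poly_fun (k * n) p \<and> E = alg_edges n k p)"
  by (simp add: algebraic_hg_def alg_edges_def)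

lemma chart_iso:
  fixes \<H> :: "(nat \<times> real list set set) set" and \<beta> :: "nat \<Rightarrow> real \<Rightarrow> real"
  assumes T: "indep F T" and ch: "chart F T ps cs e" and n: "length ps = n"
    and \<beta>: "\<And>i. i < length cs \<Longrightarrow> bij_betw (\<beta> i) (T \<inter> {cs ! i - e<..<cs ! i + e}) UNIV"
    and \<H>: "\<And>k E. (k, E) \<in> \<H> \<Longrightarrow> \<exists>p. poly_over F (k * n) p \<and> E = alg_edges n k p"
  defines "A \<equiv> ev ps ` pts T cs e"
  shows "\<exists>(d::nat) (g :: real list \<Rightarrow> real list). g ` A \<subseteq> Rn d \<and>
    (\<forall>(k, E) \<in> \<H>. \<exists>\<P>. (\<forall>P\<in>\<P>. template d k P) \<and>
      hyp_iso g A (induced_edges k E A) (Rn d) (L_edges d k \<P>) \<and> algebraic_hg d k (L_edges d k \<P>))"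
proof -
  let ?d = "length cs"
  define \<gamma> where "\<gamma> us = map (\<lambda>i. \<beta> i (us ! i)) [0..<?d]" for us :: "real list"
  define g where "g = \<gamma> \<circ> inv_into (pts T cs e) (ev ps)"
  have "bij_betw (ev ps) (pts T cs e) A" using ch by (simp add: A_def chart_def bij_betw_def)
  then have bij: "bij_betw g A (Rn ?d)"
    unfolding g_def \<gamma>_def by (intro bij_betw_trans[OF bij_betw_inv_into bij_betw_pts[OF \<beta>]])
  have "\<exists>\<P>. (\<forall>P\<in>\<P>. template ?d k P) \<and> hyp_iso g A (induced_edges k E A) (Rn ?d) (L_edges ?d k \<P>) \<and>
      algebraic_hg ?d k (L_edges ?d k \<P>)" if H: "(k, E) \<in> \<H>" for k E
  proof -
    obtain p where p: "poly_over F (k * n) p" and E: "E = alg_edges n k p" using \<H>[OF H] by blast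
    let ?E' = "(\<lambda>e. g ` e) ` induced_edges k E A"
    have "?E' \<subseteq> nsets (Rn ?d) k"
    proof (rule image_subsetI)
      fix e0 assume "e0 \<in> induced_edges k E A"
      then have e0: "e0 \<subseteq> A" "finite e0" "card e0 = k" by (auto simp: induced_edges_def nsets_def)
      have "inj_on g e0" using bij e0(1) by (auto simp: bij_betw_def intro: inj_on_subset)
      then show "g ` e0 \<in> nsets (Rn ?d) k" using e0 bij by (auto simp: nsets_def card_image bij_betw_def)
    qed
    moreover have "Q' \<in> ?E'" if "Q \<in> ?E'" "Q' \<in> nsets (Rn ?d) k" "hom_image ?d Q Q'" for Q Q'
      using chart_edges_hom_closed[OF T ch n \<beta> p] that unfolding E A_def g_def \<gamma>_def[abs_def] by blast
    ultimately obtain \<P> where \<P>: "\<forall>P\<in>\<P>. template ?d k P" "L_edges ?d k \<P> = ?E'"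
      using hom_closed_eq_L_edges[of ?E' ?d k] by blast
    then show ?thesis
      using bij algebraic_hg_L_edges[of \<P> ?d k] unfolding hyp_iso_def by (intro exI[of _ \<P>]) auto
  qed
  then show ?thesis using bij by (intro exI[of _ ?d] exI[of _ g]) (auto simp: bij_betw_def)
qed

text \<open>This settles the case that \<open>\<kappa>\<close> is the continuum.\<close>

lemma singleton_iso:
  fixes \<H> :: "(nat \<times> real list set set) set"
  assumes \<H>: "\<forall>(k, E) \<in> \<H>. 2 \<le> k"
  shows "\<exists>(d::nat) (g :: real list \<Rightarrow> real list). g ` {a} \<subseteq> Rn d \<and>
    (\<forall>(k, E) \<in> \<H>. \<exists>\<P>. (\<forall>P\<in>\<P>. template d k P) \<and>
      hyp_iso g {a} (induced_edges k E {a}) (Rn d) (L_edges d k \<P>) \<and> algebraic_hg d k (L_edges d k \<P>))"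
proof (intro exI conjI ballI)
  show "(\<lambda>_. []) ` {a} \<subseteq> Rn 0" by (simp add: Rn_def)
  fix H assume "H \<in> \<H>"
  then obtain k E where H: "H = (k, E)" and k: "2 \<le> k" using \<H> by (cases H) auto
  have "nsets {a} k = {}"
    using k by (auto simp: nsets_def subset_singleton_iff)
  then have "induced_edges k E {a} = {}" by (simp add: induced_edges_def)
  moreover have "L_edges 0 k {} = {}" by (simp add: L_edges_def)
  moreover have "bij_betw (\<lambda>_. []) {a} (Rn 0)" by (auto simp: bij_betw_def Rn_def)
  ultimately have "hyp_iso (\<lambda>_. []) {a} (induced_edges k E {a}) (Rn 0) (L_edges 0 k {})"
    by (simp add: hyp_iso_def)
  then show "case H of (k, E) \<Rightarrow> \<exists>\<P>. (\<forall>P\<in>\<P>. template 0 k P) \<and>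
      hyp_iso (\<lambda>_. []) {a} (induced_edges k E {a}) (Rn 0) (L_edges 0 k \<P>) \<and> algebraic_hg 0 k (L_edges 0 k \<P>)"
    using algebraic_hg_L_edges[of "{}" 0 k] by (auto simp: H intro!: exI[of _ "{}"])
qed

theorem theorem1p2:
  fixes n :: nat and K :: "real set" and \<H> :: "(nat \<times> real list set set) set"
  assumes "1 \<le> n"
    and "infinite K"
    and "\<exists>f. inj_on f \<H> \<and> f ` \<H> \<subseteq> K"
    and "\<forall>(k, E) \<in> \<H>. 2 \<le> k \<and> is_hypergraph k (Rn n) E \<and> algebraic_hg n k E"
  shows "\<exists>\<A> :: real list set set.
           (\<exists>f. inj_on f \<A> \<and> f ` \<A> \<subseteq> K) \<and> \<Union>\<A> = Rn n \<and>
           (\<forall>A\<in>\<A>. \<exists>(d::nat) (g :: real list \<Rightarrow> real list). g ` A \<subseteq> Rn d \<and>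
              (\<forall>(k, E) \<in> \<H>. \<exists>\<P>. (\<forall>P\<in>\<P>. template d k P) \<and>
                  hyp_iso g A (induced_edges k E A) (Rn d) (L_edges d k \<P>) \<and>
                  algebraic_hg d k (L_edges d k \<P>)))"
proof (cases "|UNIV :: real set| \<le>o |K|")
  case True
  have "|lists (UNIV :: real set)| \<le>o |K|" by (rule card_of_lists_le[OF assms(2) True])
  then have "|Rn n| \<le>o |K|"
    by (rule ordLeq_transitive[OF card_of_mono1, rotated]) auto
  then have "\<exists>f. inj_on f ((\<lambda>a. {a}) ` Rn n) \<and> f ` (\<lambda>a. {a}) ` Rn n \<subseteq> K"
    unfolding card_of_ordLeq by (rule card_of_image_le)
  moreover have "\<forall>(k, E) \<in> \<H>. 2 \<le> k" using assms(4) by auto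
  ultimately show ?thesis
    using singleton_iso[of \<H>]
    by (intro exI[of _ "(\<lambda>a. {a}) ` Rn n"] conjI ballI) (simp, simp, elim imageE, simp only:)
next
  case False
  then have small: "|K| <o |UNIV :: real set|" by (simp add: not_ordLeq_iff_ordLess card_of_Well_order)
  have "\<exists>p C. finite C \<and> poly_over C (fst H * n) p \<and> snd H = alg_edges n (fst H) p" if H: "H \<in> \<H>" for H
  proof -
    have "algebraic_hg n (fst H) (snd H)" using assms(4) H by auto
    then show ?thesis using poly_fun_imp_poly_over unfolding algebraic_hg_iff by metis
  qed
  then obtain p C where pC: "\<And>H. H \<in> \<H> \<Longrightarrow> finite (C H)" "\<And>H. H \<in> \<H> \<Longrightarrow> poly_over (C H) (fst H * n) (p H)"
    "\<And>H. H \<in> \<H> \<Longrightarrow> snd H = alg_edges n (fst H) (p H)" by metis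
  define F where "F = (\<Union>H\<in>\<H>. C H)"
  have "|\<H>| \<le>o |K|" using assms(3) by (simp add: card_of_ordLeq)
  moreover have "|C H| \<le>o |K|" if "H \<in> \<H>" for H
    using pC(1)[OF that] assms(2)
    by (intro ordLess_imp_ordLeq finite_ordLess_infinite card_of_Well_order) (simp_all add: Field_card_of)
  ultimately have F: "|F| \<le>o |K|"
    unfolding F_def using assms(2) by (intro card_of_UNION_ordLeq_infinite) auto
  obtain T where T: "indep F T" "\<And>b. \<exists>us. distinct us \<and> set us \<subseteq> T \<and> represents F us b"
    "\<And>x y. x < y \<Longrightarrow> \<exists>\<beta> :: real \<Rightarrow> real. bij_betw \<beta> (T \<inter> {x<..<y}) UNIV"
    using dense_basis_exists[OF assms(2) F small] by blast
  define piece :: "((nat \<Rightarrow> complex) \<Rightarrow> complex) list \<Rightarrow> rat list \<times> rat \<Rightarrow> real list set" where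
    "piece ps q = ev ps ` pts T (map of_rat (fst q)) (of_rat (snd q))" for ps q
  define \<A> where "\<A> = {piece ps q | ps q. length ps = n \<and> chart F T ps (map of_rat (fst q)) (of_rat (snd q))}"
  have "A \<in> (\<Union>q. (\<lambda>ps. piece ps q) ` lists (Cl F))" if A: "A \<in> \<A>" for A
  proof -
    obtain ps q where "A = piece ps q" "chart F T ps (map of_rat (fst q)) (of_rat (snd q))"
      using A by (auto simp only: \<A>_def mem_Collect_eq)
    then show ?thesis by (intro UN_I[of q] image_eqI[of _ _ ps]) (auto simp: chart_def)
  qed
  then have "\<A> \<subseteq> (\<Union>q. (\<lambda>ps. piece ps q) ` lists (Cl F))" by (rule subsetI)
  moreover have "|\<Union>q. (\<lambda>ps. piece ps q) ` lists (Cl F)| \<le>o |K|"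
    by (intro card_of_indexed_image_le card_of_lists_le card_of_Cl assms(2) F)
  ultimately have "|\<A>| \<le>o |K|"
    by (rule ordLeq_transitive[OF card_of_mono1])
  moreover have "\<Union>\<A> = Rn n"
  proof
    show "\<Union>\<A> \<subseteq> Rn n" by (auto simp: \<A>_def piece_def ev_def Rn_def)
    show "Rn n \<subseteq> \<Union>\<A>"
    proof
      fix a :: "real list" assume "a \<in> Rn n"
      then have "length a = n" by (simp add: Rn_def)
      moreover obtain ps rs r where "length ps = length a" "chart F T ps (map of_rat rs) (of_rat r)"
        "a \<in> ev ps ` pts T (map of_rat rs) (of_rat r)"
        using chart_exists[OF T(1,2)] by blast
      ultimately have "piece ps (rs, r) \<in> \<A>" "a \<in> piece ps (rs, r)"
        by (auto simp: \<A>_def piece_def)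
      then show "a \<in> \<Union>\<A>" by blast
    qed
  qed
  moreover have "\<exists>(d::nat) (g :: real list \<Rightarrow> real list). g ` A \<subseteq> Rn d \<and>
      (\<forall>(k, E) \<in> \<H>. \<exists>\<P>. (\<forall>P\<in>\<P>. template d k P) \<and>
        hyp_iso g A (induced_edges k E A) (Rn d) (L_edges d k \<P>) \<and> algebraic_hg d k (L_edges d k \<P>))"
    if A: "A \<in> \<A>" for A
  proof -
    obtain ps rs r where ps: "length ps = n" "chart F T ps (map of_rat rs) (of_rat r)"
      and A: "A = ev ps ` pts T (map of_rat rs) (of_rat r)"
      using A by (auto simp: \<A>_def piece_def)
    have "0 < (of_rat r :: real)" using ps(2) by (simp only: chart_def separated_def)
    then have "\<exists>\<beta> :: real \<Rightarrow> real. bij_betw \<beta> (T \<inter> {c - of_rat r<..<c + of_rat r}) UNIV" for c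
      by (intro T(3)) simp
    then obtain \<beta> :: "real \<Rightarrow> real \<Rightarrow> real"
      where \<beta>: "\<And>c. bij_betw (\<beta> c) (T \<inter> {c - of_rat r<..<c + of_rat r}) UNIV" by metis
    show ?thesis
      unfolding A
    proof (rule chart_iso[OF T(1) ps(2,1), where \<beta> = "\<lambda>i. \<beta> (map of_rat rs ! i)"])
      show "\<exists>p. poly_over F (k * n) p \<and> E = alg_edges n k p" if "(k, E) \<in> \<H>" for k E
        using pC(2,3)[OF that] poly_over_mono[of "C (k, E)" "k * n" "p (k, E)" F] that
        by (intro exI[of _ "p (k, E)"]) (auto simp: F_def)
    qed (rule \<beta>)
  qed
  ultimately show ?thesis
    unfolding card_of_ordLeq[symmetric] by (intro exI[of _ \<A>] conjI ballI) simp_all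
qed

end
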